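(* Let $d\ge 1$, let $\mathbb{K}\in\{\mathbb{Z},\mathbb{Q},\mathbb{R}\}$, let $X=(X_1,\dots,X_d)$ have i.i.d. standard Gaussian components, and let $Y=h(X)$ with $h\in\mathbb{K}[x_1,\dots,x_d]$ a non-constant polynomial such that $\mathbb{E}[Y]=0$. Then: (a) $APSO(Y)\subseteq PSO(Y)$. (b) When $d=1$, $APSO(Y)=PSO(Y)$ (or equivalently, $ASC(Y,T)=SC(Y,T)$ for every $T\ge 1$).
   Context: Hermite polynomials: $H_0(x)=1$, $H_n(x)=xH_{n-1}(x)-H_{n-1}'(x)$ for $n\ge1$; for a multi-index $\alpha\in\mathbb{N}_0^d$, $H_\alpha(x)=\prod_{k=1}^d H_{\alpha_k}(x_k)$ and $|\alpha|=\sum_k\alpha_k$. These form a linear basis of the space of real polynomials in $d$ variables. Gamma operator: for the given $h$, $\Gamma_Y$ is the linear operator on polynomials in $x=(x_1,\dots,x_d)$ determined by $\Gamma_Y(1)=0$ and, for $|\alpha|>0$, $$\Gamma_Y(H_\alpha)(x)=\sum_{k=1}^d\frac{\alpha_k}{|\alpha|}H_{\alpha-e_k}(x)\,\partial_{x_k}h(x),$$ where $e_k$ is the $k$-th standard basis vector and terms with $\alpha_k=0$ are zero. (For $d=1$: $\Gamma_Y(f)=h'\,\delta^{-1}f$ where $\delta^{-1}$ is linear with $\delta^{-1}1=0$, $\delta^{-1}H_n=H_{n-1}$ for $n\ge1$.) A polynomial $p(Y)$ in $Y$ is regarded as the polynomial $p(h(x))$ in $x$ when $\Gamma_Y$ is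 applied to it; polynomials in $x$ are identified with random variables by evaluation at $X$. $H(Y)$ is the Hilbert space of $\sigma(Y)$-measurable square-integrable random variables (with respect to the $d$-dimensional standard Gaussian measure), and $H(Y)^\perp$ is its orthogonal complement in $L^2$. Stein chains: for a sequence $(p_t(y)\in\mathbb{K}[y]: t=0,\dots,T)$, $T\ge 1$, define polynomials $g_t$ in $x_1,\dots,x_d$ by $g_0=0$ and $g_t=\Gamma_Y(g_{t-1}+p_{t-1}(Y))$ for $t=1,\dots,T$. The sequence is a (general, forward) Stein chain of length $T$ for $Y$ if $\mathbb{E}[g_t(X)]=-\mathbb{E}[p_t(Y)]$ for all $t=0,\dots,T$ and $g_T(X)+p_T(Y)\in H(Y)^\perp$. It is an algebraic Stein chain of length $T$ if it is a Stein chain and moreover $g_T(X)+p_T(Y)=0$ almost surely. $SC(Y,T)$ and $ASC(Y,T)$ denote the sets of Stein chains and of algebraic Stein chains of length $T$. Polynomial Stein operators: let $\mathcal{S}=\sum_{t=0}^T p_t(y)\partial^t$, $T\ge1$, be a linear differential operator with polynomial coefficients $p_t\in\mathbb{K}[y]$ ($\partial^0$ is the identity), let $m=\max_t\deg p_t$, and let $I\subseteq\mathbb{R}$ be the support of $Y$. Let $\mathcal{F}_{\mathcal{S},Y}$ be the set of all $f\in C^T(I)$ with $\mathbb{E}|Y^jf^{(t)}(Y)|<\infty$ for all $t=0,\dots,T$ and $j=0,\dots,m$. Then $\mathcal{S}\in PSO(Y)$ ($\mathcal{S}$ is a polynomial Stein operator for $Y$) means that $\mathcal{S}f(Y)\in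 L^1$ and $\mathbb{E}[\mathcal{S}f(Y)]=0$ for all $f\in\mathcal{F}_{\mathcal{S},Y}$. An operator $\mathcal{S}=\sum_{t=0}^Tp_t\partial^t\in PSO(Y)$ is an algebraic polynomial Stein operator if $(p_t(y):t=0,\dots,T)\in ASC(Y,T)$; $APSO(Y)$ is the class of all algebraic polynomial Stein operators for $Y$. *)

theory Defs
  imports
    "HOL-Probability.Probability"
    "HOL-Computational_Algebra.Polynomial"
    "HOL-Library.Poly_Mapping"
begin

section \<open>Real polynomials in several variables\<close>

text \<open>
  An element of \<^typ>\<open>'n \<Rightarrow>\<^sub>0 nat\<close> is a multi-index (exponent vector), and a polynomial maps
  multi-indices to coefficients; multiplication is the convolution of \<^theory>\<open>HOL-Library.Poly_Mapping\<close>.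
  With \<open>'n\<close> of class finite, the number of variables is \<open>CARD('n) \<ge> 1\<close>.
\<close>

type_synonym 'n mpoly = "('n \<Rightarrow>\<^sub>0 nat) \<Rightarrow>\<^sub>0 real"

definition mconst :: "real \<Rightarrow> 'n mpoly" where
  "mconst c = Poly_Mapping.single 0 c"

definition mvar :: "'n \<Rightarrow> 'n mpoly" where
  "mvar k = Poly_Mapping.single (Poly_Mapping.single k 1) 1"

definition mdeg :: "('n::finite \<Rightarrow>\<^sub>0 nat) \<Rightarrow> nat" where
  "mdeg \<alpha> = (\<Sum>k\<in>UNIV. Poly_Mapping.lookup \<alpha> k)"

definition meval :: "'n::finite mpoly \<Rightarrow> ('n \<Rightarrow> real) \<Rightarrow> real" where
  "meval p x = (\<Sum>\<alpha>\<in>Poly_Mapping.keys p.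
     Poly_Mapping.lookup p \<alpha> * (\<Prod>k\<in>UNIV. x k ^ Poly_Mapping.lookup \<alpha> k))"

text \<open>In the next definition, terms with \<open>\<alpha>\<^sub>k = 0\<close> (where the subtraction truncates) have coefficient 0.\<close>

definition mpderiv :: "'n \<Rightarrow> 'n mpoly \<Rightarrow> 'n mpoly" where
  "mpderiv k p = (\<Sum>\<alpha>\<in>Poly_Mapping.keys p.
     Poly_Mapping.single (\<alpha> - Poly_Mapping.single k 1)
       (real (Poly_Mapping.lookup \<alpha> k) * Poly_Mapping.lookup p \<alpha>))"

text \<open>The polynomial \<open>p(q)\<close> in several variables obtained by substituting \<open>q\<close> into a univariate \<open>p\<close>.\<close>

definition msubst :: "real poly \<Rightarrow> 'n mpoly \<Rightarrow> 'n mpoly" where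
  "msubst p q = poly (map_poly mconst p) q"


section \<open>Hermite polynomials and the Gamma operator\<close>

fun hermite :: "nat \<Rightarrow> real poly" where
  "hermite 0 = 1"
| "hermite (Suc n) = [:0, 1:] * hermite n - pderiv (hermite n)"

definition mhermite :: "('n::finite \<Rightarrow>\<^sub>0 nat) \<Rightarrow> 'n mpoly" where
  "mhermite \<alpha> = (\<Prod>k\<in>UNIV. msubst (hermite (Poly_Mapping.lookup \<alpha> k)) (mvar k))"

definition mlinear :: "('n mpoly \<Rightarrow> 'n mpoly) \<Rightarrow> bool" where
  "mlinear G \<longleftrightarrow> (\<forall>p q. G (p + q) = G p + G q) \<and> (\<forall>c p. G (mconst c * p) = mconst c * G p)"

definition is_gamma_op :: "'n::finite mpoly \<Rightarrow> ('n mpoly \<Rightarrow> 'n mpoly) \<Rightarrow> bool" where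
  "is_gamma_op h G \<longleftrightarrow> mlinear G \<and> G 1 = 0 \<and>
     (\<forall>\<alpha>. mdeg \<alpha> > 0 \<longrightarrow> G (mhermite \<alpha>) =
        (\<Sum>k\<in>UNIV. mconst (real (Poly_Mapping.lookup \<alpha> k) / real (mdeg \<alpha>))
           * mhermite (\<alpha> - Poly_Mapping.single k 1) * mpderiv k h))"

text \<open>Existence and uniqueness of this operator are proved at the end of the theory.\<close>

definition gamma_op :: "'n::finite mpoly \<Rightarrow> 'n mpoly \<Rightarrow> 'n mpoly" where
  "gamma_op h = (THE G. is_gamma_op h G)"


section \<open>Square-integrable random variables\<close>

definition L2_rv :: "'w measure \<Rightarrow> ('w \<Rightarrow> real) set" where
  "L2_rv M = {Z. Z \<in> borel_measurable M \<and> integrable M (\<lambda>\<omega>. (Z \<omega>)\<^sup>2)}"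

text \<open>\<open>H(Y)\<close>: the measurability is with respect to \<open>\<sigma>(Y)\<close>, the smallest sigma-algebra making \<open>Y\<close> measurable.\<close>

definition H_space :: "'w measure \<Rightarrow> ('w \<Rightarrow> real) \<Rightarrow> ('w \<Rightarrow> real) set" where
  "H_space M Y = {W. W \<in> borel_measurable (vimage_algebra (space M) Y borel) \<and>
     integrable M (\<lambda>\<omega>. (W \<omega>)\<^sup>2)}"

definition H_perp :: "'w measure \<Rightarrow> ('w \<Rightarrow> real) \<Rightarrow> ('w \<Rightarrow> real) set" where
  "H_perp M Y = {Z \<in> L2_rv M. \<forall>W\<in>H_space M Y. (LINT \<omega>|M. Z \<omega> * W \<omega>) = 0}"


section \<open>Stein chains\<close>

text \<open>Polynomials in \<open>x\<close> are identified with random variables by evaluation at \<open>X\<close>; in particular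
  \<open>Y = rv X h\<close>.\<close>

definition rv :: "('n::finite \<Rightarrow> 'w \<Rightarrow> real) \<Rightarrow> 'n mpoly \<Rightarrow> 'w \<Rightarrow> real" where
  "rv X p \<omega> = meval p (\<lambda>k. X k \<omega>)"

text \<open>A sequence \<open>p\<^sub>0, \<dots>, p\<^sub>T\<close> is encoded as a list of length \<open>T + 1\<close>.\<close>

primrec chain_poly :: "'n::finite mpoly \<Rightarrow> real poly list \<Rightarrow> nat \<Rightarrow> 'n mpoly" where
  "chain_poly h ps 0 = 0"
| "chain_poly h ps (Suc t) = gamma_op h (chain_poly h ps t + msubst (ps ! t) h)"

definition poly_seqs :: "real set \<Rightarrow> nat \<Rightarrow> real poly list set" where
  "poly_seqs K T = {ps. length ps = T + 1 \<and> (\<forall>p\<in>set ps. \<forall>i. coeff p i \<in> K)}"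

definition SC ::
  "real set \<Rightarrow> 'w measure \<Rightarrow> ('n::finite \<Rightarrow> 'w \<Rightarrow> real) \<Rightarrow> 'n mpoly \<Rightarrow> nat \<Rightarrow> real poly list set" where
  "SC K M X h T = {ps \<in> poly_seqs K T.
     (\<forall>t\<le>T. (LINT \<omega>|M. rv X (chain_poly h ps t) \<omega>) = - (LINT \<omega>|M. poly (ps ! t) (rv X h \<omega>))) \<and>
     (\<lambda>\<omega>. rv X (chain_poly h ps T) \<omega> + poly (ps ! T) (rv X h \<omega>)) \<in> H_perp M (rv X h)}"

definition ASC ::
  "real set \<Rightarrow> 'w measure \<Rightarrow> ('n::finite \<Rightarrow> 'w \<Rightarrow> real) \<Rightarrow> 'n mpoly \<Rightarrow> nat \<Rightarrow> real poly list set" where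
  "ASC K M X h T = {ps \<in> SC K M X h T.
     AE \<omega> in M. rv X (chain_poly h ps T) \<omega> + poly (ps ! T) (rv X h \<omega>) = 0}"


section \<open>Polynomial Stein operators\<close>

definition rv_support :: "'w measure \<Rightarrow> ('w \<Rightarrow> real) \<Rightarrow> real set" where
  "rv_support M Y = {y. \<forall>e>0. measure (distr M borel Y) (ball y e) > 0}"

text \<open>Derivatives on \<open>I\<close> are taken within \<open>I\<close>, hence one-sided at the end points of an interval.
  Only the values of \<open>f\<close> on \<open>I\<close> matter for the values on \<open>I\<close> of the derivatives.\<close>

primrec nderiv_on :: "real set \<Rightarrow> nat \<Rightarrow> (real \<Rightarrow> real) \<Rightarrow> real \<Rightarrow> real" where
  "nderiv_on I 0 f = f"
| "nderiv_on I (Suc t) f = (\<lambda>y. vector_derivative (nderiv_on I t f) (at y within I))"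

definition C_on :: "nat \<Rightarrow> real set \<Rightarrow> (real \<Rightarrow> real) set" where
  "C_on T I = {f. (\<forall>t<T. nderiv_on I t f differentiable_on I) \<and>
     (\<forall>t\<le>T. continuous_on I (nderiv_on I t f))}"

text \<open>The operator \<open>\<S> = \<Sum>\<^sub>t p\<^sub>t(y) \<partial>\<^sup>t\<close>, \<open>t = 0, \<dots>, T\<close>, is given by its coefficient list
  \<open>[p\<^sub>0, \<dots>, p\<^sub>T]\<close>, so that \<open>T\<close> is the length of the list minus one.\<close>

definition stein_apply :: "real poly list \<Rightarrow> real set \<Rightarrow> (real \<Rightarrow> real) \<Rightarrow> real \<Rightarrow> real" where
  "stein_apply ps I f y = (\<Sum>t<length ps. poly (ps ! t) y * nderiv_on I t f y)"

definition test_functions :: "'w measure \<Rightarrow> ('w \<Rightarrow> real) \<Rightarrow> real poly list \<Rightarrow> (real \<Rightarrow> real) set" where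
  "test_functions M Y ps =
     (let T = length ps - 1; m = Max (degree ` set ps); I = rv_support M Y in
      {f \<in> C_on T I. \<forall>t\<le>T. \<forall>j\<le>m. integrable M (\<lambda>\<omega>. Y \<omega> ^ j * nderiv_on I t f (Y \<omega>))})"

definition PSO ::
  "real set \<Rightarrow> 'w measure \<Rightarrow> ('n::finite \<Rightarrow> 'w \<Rightarrow> real) \<Rightarrow> 'n mpoly \<Rightarrow> real poly list set" where
  "PSO K M X h = {ps. \<exists>T\<ge>1. ps \<in> poly_seqs K T \<and>
     (\<forall>f\<in>test_functions M (rv X h) ps.
        integrable M (\<lambda>\<omega>. stein_apply ps (rv_support M (rv X h)) f (rv X h \<omega>)) \<and>
        (LINT \<omega>|M. stein_apply ps (rv_support M (rv X h)) f (rv X h \<omega>)) = 0)}"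

definition APSO ::
  "real set \<Rightarrow> 'w measure \<Rightarrow> ('n::finite \<Rightarrow> 'w \<Rightarrow> real) \<Rightarrow> 'n mpoly \<Rightarrow> real poly list set" where
  "APSO K M X h = {ps \<in> PSO K M X h. ps \<in> ASC K M X h (length ps - 1)}"

section \<open>The Gamma operator is well defined\<close>

text \<open>\<open>degbd k p\<close>: total degree below \<open>k\<close>. \<open>near \<alpha> p\<close>: \<open>p\<close> is \<open>x\<^sup>\<alpha>\<close> plus terms of lower total degree.\<close>

definition degbd :: "nat \<Rightarrow> 'n::finite mpoly \<Rightarrow> bool" where
  "degbd k p \<longleftrightarrow> (\<forall>\<alpha>\<in>Poly_Mapping.keys p. mdeg \<alpha> < k)"

lemma mdeg_add: "mdeg (\<alpha> + \<beta>) = mdeg \<alpha> + mdeg \<beta>"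
  by (simp add: mdeg_def lookup_add sum.distrib)

lemma degbd_add: "degbd k p \<Longrightarrow> degbd k q \<Longrightarrow> degbd k (p + q)"
  using Poly_Mapping.keys_add[of p q] by (auto simp: degbd_def)

lemma degbd_sum: "(\<And>i. i \<in> A \<Longrightarrow> degbd k (f i)) \<Longrightarrow> degbd k (sum f A)"
  by (induction A rule: infinite_finite_induct) (auto intro: degbd_add simp: degbd_def[of _ 0])

lemma degbd_mono: "degbd k p \<Longrightarrow> k \<le> l \<Longrightarrow> degbd l p"
  by (force simp: degbd_def)

lemma degbd_mult: "degbd k p \<Longrightarrow> degbd (Suc l) q \<Longrightarrow> degbd (k + l) (p * q)"
  using Poly_Mapping.keys_mult[of p q] by (fastforce simp: degbd_def mdeg_add)

lemma degbd_const: "degbd k p \<Longrightarrow> degbd k (mconst c * p)"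
  using Poly_Mapping.keys_mult[of "mconst c" p]
  by (fastforce simp: degbd_def mdeg_add mconst_def split: if_splits)

lemma degbd_single: "mdeg \<alpha> < k \<Longrightarrow> degbd k (Poly_Mapping.single \<alpha> c)"
  by (auto simp: degbd_def)

definition near :: "('n::finite \<Rightarrow>\<^sub>0 nat) \<Rightarrow> 'n mpoly \<Rightarrow> bool" where
  "near \<alpha> p \<longleftrightarrow> degbd (mdeg \<alpha>) (p - Poly_Mapping.single \<alpha> 1)"

lemma near_mult:
  assumes "near \<alpha> p" "near \<beta> q" shows "near (\<alpha> + \<beta>) (p * q)"
proof -
  have q: "degbd (Suc (mdeg \<beta>)) q"
  proof -
    have "degbd (Suc (mdeg \<beta>)) ((q - Poly_Mapping.single \<beta> 1) + Poly_Mapping.single \<beta> 1)"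
      using assms(2) by (intro degbd_add degbd_single) (auto simp: near_def intro: degbd_mono)
    then show ?thesis by simp
  qed
  have "degbd (mdeg \<alpha> + mdeg \<beta>) ((p - Poly_Mapping.single \<alpha> 1) * q)"
    using assms(1) q by (auto simp: near_def intro: degbd_mult)
  moreover have "degbd (mdeg \<beta> + mdeg \<alpha>) ((q - Poly_Mapping.single \<beta> 1) * Poly_Mapping.single \<alpha> 1)"
    using assms(2) by (auto simp: near_def intro!: degbd_mult degbd_single)
  ultimately have "degbd (mdeg \<alpha> + mdeg \<beta>) ((p - Poly_Mapping.single \<alpha> 1) * q +
     (q - Poly_Mapping.single \<beta> 1) * Poly_Mapping.single \<alpha> 1)"
    by (intro degbd_add) (simp_all add: add.commute)
  also have "(p - Poly_Mapping.single \<alpha> 1) * q +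
     (q - Poly_Mapping.single \<beta> 1) * Poly_Mapping.single \<alpha> 1
     = p * q - Poly_Mapping.single (\<alpha> + \<beta>) 1"
    by (simp add: algebra_simps mult_single)
  finally show ?thesis by (simp add: near_def mdeg_add)
qed

lemma near_prod:
  assumes "finite A" "\<And>k. k \<in> A \<Longrightarrow> near (a k) (p k)"
  shows "near (\<Sum>k\<in>A. a k) (\<Prod>k\<in>A. p k)"
  using assms
proof (induction A rule: finite_induct)
  case empty
  show ?case by (simp add: near_def degbd_def)
next
  case (insert k A)
  then show ?case by (simp add: near_mult)
qed

lemma hermite_degree: "degree (hermite n) = n \<and> coeff (hermite n) n = 1"
proof (induction n)
  case (Suc n)
  have d: "degree (pderiv (hermite n)) \<le> n" using Suc by (simp add: degree_pderiv)
  have e: "degree ([:0, 1:] * hermite n) = Suc n"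
  proof -
    have "hermite n \<noteq> 0" using Suc by auto
    then show ?thesis using Suc by (subst degree_mult_eq) auto
  qed
  have c: "coeff (hermite (Suc n)) (Suc n) = 1"
    using Suc d by (simp add: coeff_eq_0)
  moreover have "degree (hermite (Suc n)) \<le> Suc n"
    using d e by (auto intro!: degree_diff_le simp del: mult_pCons_left)
  ultimately show ?case by (metis le_degree le_antisym zero_neq_one)
qed simp

lemma mvar_power: "mvar k ^ i = Poly_Mapping.single (Poly_Mapping.single k i) 1"
  by (induction i) (auto simp: mvar_def mult_single single_add[symmetric])

lemma mdeg_single: "mdeg (Poly_Mapping.single k i) = i"
  by (simp add: mdeg_def lookup_single when_def)

lemma msubst_mvar:
  "msubst p (mvar k) = (\<Sum>i\<le>degree p. Poly_Mapping.single (Poly_Mapping.single k i) (coeff p i))"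
proof -
  have "degree (map_poly mconst p) \<le> degree p"
    by (auto intro!: degree_le simp: coeff_map_poly mconst_def coeff_eq_0)
  then have "msubst p (mvar k) = (\<Sum>i\<le>degree p. coeff (map_poly mconst p) i * mvar k ^ i)"
    unfolding msubst_def poly_altdef
    by (intro sum.mono_neutral_left) (auto simp: coeff_eq_0)
  also have "\<dots> = (\<Sum>i\<le>degree p. Poly_Mapping.single (Poly_Mapping.single k i) (coeff p i))"
    by (intro sum.cong) (auto simp: coeff_map_poly mconst_def mvar_power mult_single)
  finally show ?thesis .
qed

lemma near_hermite: "near (Poly_Mapping.single k n) (msubst (hermite n) (mvar k))"
proof -
  have "msubst (hermite n) (mvar k) - Poly_Mapping.single (Poly_Mapping.single k n) 1
     = (\<Sum>i<n. Poly_Mapping.single (Poly_Mapping.single k i) (coeff (hermite n) i))"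
    using hermite_degree[of n] by (simp add: msubst_mvar lessThan_Suc_atMost[symmetric])
  then show ?thesis
    by (auto simp: near_def mdeg_single intro!: degbd_sum degbd_single)
qed

lemma index_sum: "(\<Sum>k\<in>UNIV. Poly_Mapping.single k (Poly_Mapping.lookup \<alpha> k)) = (\<alpha> :: 'n::finite \<Rightarrow>\<^sub>0 nat)"
  by (rule poly_mapping_eqI) (simp add: lookup_sum lookup_single when_def)

lemma near_mhermite: "near \<alpha> (mhermite \<alpha>)"
  using near_prod[of UNIV "\<lambda>k. Poly_Mapping.single k (Poly_Mapping.lookup \<alpha> k)"
      "\<lambda>k. msubst (hermite (Poly_Mapping.lookup \<alpha> k)) (mvar k)"]
  by (simp add: near_hermite index_sum mhermite_def)

text \<open>Linear extension from the basis of monomials, and the linear map \<open>HT\<close> sending \<open>x\<^sup>\<alpha>\<close> to \<open>H\<^sub>\<alpha>\<close>,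
  which is bijective because \<open>id - HT\<close> lowers the degree.\<close>

definition mext :: "(('n \<Rightarrow>\<^sub>0 nat) \<Rightarrow> 'n mpoly) \<Rightarrow> 'n mpoly \<Rightarrow> 'n mpoly" where
  "mext \<phi> p = (\<Sum>\<alpha>\<in>Poly_Mapping.keys p. mconst (Poly_Mapping.lookup p \<alpha>) * \<phi> \<alpha>)"

lemma mconst_add: "mconst (a + b) = mconst a + mconst b" by (simp add: mconst_def single_add)
lemma mconst_mult: "mconst (a * b) = mconst a * mconst b" by (simp add: mconst_def mult_single)
lemma mconst_0 [simp]: "mconst 0 = 0" by (simp add: mconst_def)
lemma mconst_1 [simp]: "mconst 1 = 1" by (simp add: mconst_def)
lemma lookup_mconst_mult: "Poly_Mapping.lookup (mconst c * p) \<alpha> = c * Poly_Mapping.lookup p \<alpha>"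
  by (simp add: mconst_def mult_map_scale_conv_mult[symmetric] Poly_Mapping.map.rep_eq when_def)

lemma mext_superset:
  assumes "finite A" "Poly_Mapping.keys p \<subseteq> A"
  shows "mext \<phi> p = (\<Sum>\<alpha>\<in>A. mconst (Poly_Mapping.lookup p \<alpha>) * \<phi> \<alpha>)"
  unfolding mext_def using assms
  by (intro sum.mono_neutral_left) (auto simp: in_keys_iff)

lemma mext_linear: "mlinear (mext \<phi>)" for \<phi> :: "('n \<Rightarrow>\<^sub>0 nat) \<Rightarrow> 'n mpoly"
  unfolding mlinear_def
proof (intro conjI allI)
  fix p q :: "'n mpoly"
  let ?A = "Poly_Mapping.keys p \<union> Poly_Mapping.keys q"
  have "Poly_Mapping.keys (p + q) \<subseteq> ?A" by (rule Poly_Mapping.keys_add)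
  then show "mext \<phi> (p + q) = mext \<phi> p + mext \<phi> q"
    using mext_superset[of ?A "p + q" \<phi>] mext_superset[of ?A p \<phi>] mext_superset[of ?A q \<phi>]
    by (simp add: lookup_add mconst_add distrib_right sum.distrib)
next
  fix c and p :: "'n mpoly"
  have "Poly_Mapping.keys (mconst c * p) \<subseteq> Poly_Mapping.keys p"
    by (auto simp: in_keys_iff lookup_mconst_mult)
  then show "mext \<phi> (mconst c * p) = mconst c * mext \<phi> p"
    using mext_superset[of "Poly_Mapping.keys p" "mconst c * p" \<phi>]
    by (simp add: lookup_mconst_mult mconst_mult mult.assoc sum_distrib_left mext_def)
qed

lemma mext_single: "mext \<phi> (Poly_Mapping.single \<alpha> 1) = \<phi> \<alpha>"
  by (simp add: mext_def)

lemma mlinear_0: "mlinear G \<Longrightarrow> G 0 = 0"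
  unfolding mlinear_def by (metis mconst_0 mult_zero_left)

lemma mlinear_sum: "mlinear G \<Longrightarrow> G (sum f A) = (\<Sum>i\<in>A. G (f i))"
  by (induction A rule: infinite_finite_induct) (auto simp: mlinear_0, auto simp: mlinear_def)

lemma mlinear_diff: "mlinear G \<Longrightarrow> G (p - q) = G p - G q"
  unfolding mlinear_def by (metis add_diff_cancel diff_add_cancel)

lemma mpoly_expand: "mext (\<lambda>\<alpha>. Poly_Mapping.single \<alpha> 1) p = p"
proof (rule poly_mapping_eqI)
  fix \<beta>
  show "Poly_Mapping.lookup (mext (\<lambda>\<alpha>. Poly_Mapping.single \<alpha> 1) p) \<beta> = Poly_Mapping.lookup p \<beta>"
    by (simp add: mext_def lookup_sum lookup_mconst_mult lookup_single when_def in_keys_iff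
        if_distrib sum.delta cong: if_cong)
qed

abbreviation HT :: "'n::finite mpoly \<Rightarrow> 'n mpoly" where
  "HT \<equiv> mext mhermite"

definition HN :: "'n::finite mpoly \<Rightarrow> 'n mpoly" where
  "HN p = p - HT p"

lemma HN_degbd: assumes "degbd (Suc k) p" shows "degbd k (HN p)"
proof -
  have "HN p = mext (\<lambda>\<alpha>. Poly_Mapping.single \<alpha> 1) p - HT p"
    by (simp add: HN_def mpoly_expand)
  also have "\<dots> = (\<Sum>\<alpha>\<in>Poly_Mapping.keys p. mconst (- Poly_Mapping.lookup p \<alpha>) *
      (mhermite \<alpha> - Poly_Mapping.single \<alpha> 1))"
    unfolding mext_def sum_subtractf[symmetric]
    by (intro sum.cong) (auto simp: algebra_simps mconst_def single_uminus)
  finally have eq: "HN p = \<dots>" .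
  have "degbd k (mhermite \<alpha> - Poly_Mapping.single \<alpha> 1)" if "\<alpha> \<in> Poly_Mapping.keys p" for \<alpha>
  proof (rule degbd_mono)
    show "degbd (mdeg \<alpha>) (mhermite \<alpha> - Poly_Mapping.single \<alpha> 1)"
      using near_mhermite by (simp add: near_def)
    show "mdeg \<alpha> \<le> k"
      using assms that by (auto simp: degbd_def less_Suc_eq_le)
  qed
  then show ?thesis
    unfolding eq by (intro degbd_sum degbd_const)
qed

lemma HN_nilpotent: "\<exists>k. (HN ^^ k) p = 0"
proof -
  have "degbd k p \<Longrightarrow> (HN ^^ k) p = 0" for k p
    by (induction k arbitrary: p) (auto simp: degbd_def[of 0] HN_degbd funpow_swap1 )
  moreover have "degbd (Suc (Max (insert 0 (mdeg ` Poly_Mapping.keys p)))) p"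
    by (auto simp: degbd_def less_Suc_eq_le)
  ultimately show ?thesis by blast
qed

lemma bij_HT: "bij (HT :: 'n::finite mpoly \<Rightarrow> _)"
proof (rule bijI)
  note lin = mext_linear[of "mhermite :: _ \<Rightarrow> 'n mpoly"]
  show "inj (HT :: 'n mpoly \<Rightarrow> _)"
  proof (rule injI)
    fix p q :: "'n mpoly" assume "HT p = HT q"
    then have "HN (p - q) = p - q" by (simp add: HN_def mlinear_diff[OF lin])
    then have "(HN ^^ k) (p - q) = p - q" for k by (induction k) auto
    with HN_nilpotent[of "p - q"] show "p = q" by auto
  qed
  show "surj (HT :: 'n mpoly \<Rightarrow> _)"
  proof
    show "UNIV \<subseteq> range (HT :: 'n mpoly \<Rightarrow> _)"
    proof
      fix q :: "'n mpoly"
      obtain k where k: "(HN ^^ k) q = 0" using HN_nilpotent by blast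
      have "HT (\<Sum>i<k. (HN ^^ i) q) = (\<Sum>i<k. (HN ^^ i) q - (HN ^^ Suc i) q)"
        by (simp add: mlinear_sum[OF lin] HN_def)
      also have "\<dots> = q" using k by (subst sum_lessThan_telescope') auto
      finally show "q \<in> range HT" by (metis rangeI)
    qed
  qed simp
qed

lemma mhermite_0: "mhermite 0 = 1"
  by (simp add: mhermite_def msubst_def)

theorem ex1_gamma_op: "\<exists>!G. is_gamma_op h G" for h :: "'n::finite mpoly"
proof (rule ex_ex1I)
  define \<phi> :: "('n \<Rightarrow>\<^sub>0 nat) \<Rightarrow> 'n mpoly" where "\<phi> = (\<lambda>\<alpha>. if mdeg \<alpha> = 0 then 0 else
    (\<Sum>k\<in>UNIV. mconst (real (Poly_Mapping.lookup \<alpha> k) / real (mdeg \<alpha>))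
           * mhermite (\<alpha> - Poly_Mapping.single k 1) * mpderiv k h))"
  define G where "G = mext \<phi> \<circ> inv HT"
  note lin = mext_linear[of "mhermite :: _ \<Rightarrow> 'n mpoly"]
  have invHT: "inv HT (HT p) = p" "HT (inv HT p) = p" for p :: "'n mpoly"
    using bij_HT[where 'n = 'n] by (auto simp: bij_def surj_f_inv_f)
  have invlin: "mlinear (inv HT :: 'n mpoly \<Rightarrow> _)"
    using lin unfolding mlinear_def by (metis invHT)
  have "mlinear G"
    using invlin mext_linear[of \<phi>] by (simp add: mlinear_def G_def)
  moreover have GH: "G (mhermite \<alpha>) = \<phi> \<alpha>" for \<alpha>
    unfolding G_def using invHT(1)[of "Poly_Mapping.single \<alpha> 1"] by (simp add: mext_single)
  moreover have "G 1 = 0"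
    using GH[of 0] by (simp add: mhermite_0 \<phi>_def mdeg_def)
  ultimately show "\<exists>G. is_gamma_op h G"
    unfolding is_gamma_op_def by (intro exI[of _ G]) (auto simp: \<phi>_def)
next
  fix G G' assume G: "is_gamma_op h G" "is_gamma_op h G'"
  have *: "G (mhermite \<alpha>) = G' (mhermite \<alpha>)" for \<alpha>
  proof (cases "mdeg \<alpha> = 0")
    case True
    then have "\<alpha> = 0" by (intro poly_mapping_eqI) (auto simp: mdeg_def)
    then show ?thesis using G by (simp add: is_gamma_op_def mhermite_0)
  next
    case False
    then show ?thesis using G by (simp add: is_gamma_op_def)
  qed
  have "G (HT p) = G' (HT p)" for p
  proof -
    have exp: "F (HT p) = (\<Sum>\<alpha>\<in>Poly_Mapping.keys p. mconst (Poly_Mapping.lookup p \<alpha>) * F (mhermite \<alpha>))"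
      if "mlinear F" for F
      using that unfolding mext_def mlinear_sum[OF that] by (simp add: mlinear_def)
    have lin: "mlinear G" "mlinear G'" using G by (simp_all add: is_gamma_op_def)
    show ?thesis unfolding exp[OF lin(1)] exp[OF lin(2)] * ..
  qed
  then show "G = G'" using bij_HT by (metis bij_def ext surjD)
qed

lemma is_gamma_op_gamma_op: "is_gamma_op h (gamma_op h)"
  unfolding gamma_op_def by (rule theI'[OF ex1_gamma_op])

end

theory Submission
  imports
    Defs
    "HOL-Computational_Algebra.Computational_Algebra"
    "HOL-Computational_Algebra.Field_as_Ring"
begin

text \<open>
  Part (a) is immediate. For (b), in one variable a polynomial is \<open>c + x u - u'\<close> for a unique \<open>u\<close>, its
  image under the Gamma operator is \<open>h' u\<close>, and \<open>(u \<phi>)' = -(x u - u') \<phi>\<close> for the Gaussian density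
  \<open>\<phi>\<close>. Repeated integration by parts turns \<open>E[\<S>f(Y)]\<close> into
  \<open>\<Sum>\<^sub>t c\<^sub>t E[f\<^sup>(\<^sup>t\<^sup>)(Y)] + E[q(X) f\<^sup>(\<^sup>T\<^sup>)(Y)]\<close> with \<open>q = g\<^sub>T + p\<^sub>T(h)\<close>. Testing with monomials and with
  truncated powers shows that a polynomial Stein operator, like a Stein chain, satisfies
  \<open>E[q(X); a \<le> Y \<le> b] = 0\<close> for all \<open>a \<le> b\<close>, and it remains to deduce \<open>q = 0\<close>.

  For large \<open>y\<close> (and \<open>h\<close> with positive leading coefficient) the fibre \<open>h = y\<close> is one point, in which
  case \<open>q = 0\<close>, or two points \<open>s \<rightarrow> \<infinity>\<close> and \<open>t \<rightarrow> -\<infinity>\<close> at which \<open>q\<phi>/h'\<close> agrees. The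
  logarithmic derivative in \<open>y\<close> then shows that a rational function \<open>A\<close> with \<open>A(x) \<sim> - x / h'(x)\<close>
  agrees at \<open>s\<close> and \<open>t\<close>, as does \<open>h\<close>. Comparing degrees, this forces \<open>x\<close> to be at most quadratic
  over the field of functions agreeing at \<open>s\<close> and \<open>t\<close>, so \<open>s + t\<close> is a rational function of \<open>s\<close>;
  \<open>t\<close> being integral over the polynomials in \<open>s\<close>, it is a polynomial, and so \<open>t = c - s\<close>.
  Comparing growth, \<open>c = 0\<close>, so \<open>h\<close> is even and \<open>q\<close> is odd. But for even \<open>h\<close> the Stein chain
  recursion only produces even polynomials.
\<close>

section \<open>Two points with the same values of rational functions\<close>

text \<open>Gaussian elimination: a member with nonzero coefficient at \<open>L\<close> is the pivot
  that clears this coefficient from the others. The bound speaks of coefficients rather than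
  degrees, so that \<open>L = 0\<close> can mean that all members vanish.\<close>

lemma poly_family_dependent:
  fixes r :: "'i \<Rightarrow> real poly"
  assumes "finite A" "L < card A" "\<And>i k. i \<in> A \<Longrightarrow> L \<le> k \<Longrightarrow> coeff (r i) k = 0"
  shows "\<exists>c. (\<exists>i\<in>A. c i \<noteq> 0) \<and> (\<Sum>i\<in>A. smult (c i) (r i)) = 0"
  using assms
proof (induction L arbitrary: A r)
  case 0
  then have "r i = 0" if "i \<in> A" for i using that by (intro poly_eqI) auto
  moreover have "A \<noteq> {}" using 0 by auto
  ultimately show ?case by (intro exI[of _ "\<lambda>_. 1"]) auto
next
  case (Suc L)
  show ?case
  proof (cases "\<forall>i\<in>A. coeff (r i) L = 0")
    case True
    then have "coeff (r i) k = 0" if "i \<in> A" "L \<le> k" for i k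
      using that Suc.prems(3)[of i k] by (cases "k = L") auto
    then show ?thesis using Suc.IH[of A r] Suc.prems by auto
  next
    case False
    then obtain j where j: "j \<in> A" "coeff (r j) L \<noteq> 0" by auto
    define e where "e i = coeff (r i) L / coeff (r j) L" for i
    define r' where "r' i = r i - smult (e i) (r j)" for i
    have "coeff (r' i) k = 0" if "i \<in> A - {j}" "L \<le> k" for i k
      using that Suc.prems(3)[of i k] Suc.prems(3)[of j k] j
      by (cases "k = L") (auto simp: r'_def e_def)
    moreover have "L < card (A - {j})" using Suc.prems j by simp
    ultimately obtain c where c: "\<exists>i\<in>A - {j}. c i \<noteq> 0" "(\<Sum>i\<in>A - {j}. smult (c i) (r' i)) = 0"
      using Suc.IH[of "A - {j}" r'] Suc.prems(1) by auto
    \<comment> \<open>This weight of the pivot cancels the multiples of \<open>r j\<close> that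
      reappear when each \<open>r' i\<close> is replaced by \<open>r i\<close>.\<close>
    define c' where "c' i = (if i = j then - (\<Sum>i\<in>A - {j}. c i * e i) else c i)" for i
    have "(\<Sum>i\<in>A. smult (c' i) (r i)) = smult (c' j) (r j) + (\<Sum>i\<in>A - {j}. smult (c i) (r i))"
      using j Suc.prems(1) by (subst sum.remove[of A j]) (auto simp: c'_def intro!: sum.cong)
    also have "(\<Sum>i\<in>A - {j}. smult (c i) (r i))
        = (\<Sum>i\<in>A - {j}. smult (c i) (r' i)) + (\<Sum>i\<in>A - {j}. smult (c i * e i) (r j))"
      by (simp add: r'_def smult_diff_right sum_subtractf)
    also have "(\<Sum>i\<in>A - {j}. smult (c i * e i) (r j)) = smult (- c' j) (r j)"
      by (simp add: c'_def smult_sum)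
    finally have "(\<Sum>i\<in>A. smult (c' i) (r i)) = 0" using c by simp
    moreover have "\<exists>i\<in>A. c' i \<noteq> 0" using c(1) by (auto simp: c'_def)
    ultimately show ?thesis by blast
  qed
qed

lemma pcompose_power: "pcompose (p ^ i) q = pcompose p q ^ i" for q :: "'a::comm_semiring_1 poly"
  by (induction i) (auto simp: pcompose_mult pcompose_1)

lemma pcompose_poly_altdef:
  "pcompose (\<Sum>i\<in>A. monom (c i) i) (h :: real poly) = (\<Sum>i\<in>A. smult (c i) (h ^ i))"
  by (induction A rule: infinite_finite_induct)
     (auto simp: pcompose_add monom_altdef pcompose_smult pcompose_mult pcompose_power pcompose_pCons)

text \<open>The residues \<open>h ^ i mod D\<close> for \<open>i\<close> up to
  \<open>degree D\<close> outnumber the dimension of the space of residues, and a linear relation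
  between them gives \<open>c\<close>. It serves to clear a denominator \<open>D\<close> by a
  polynomial in \<open>h\<close>.\<close>

lemma dvd_pcompose_exists:
  fixes D h :: "real poly"
  assumes "D \<noteq> 0"
  shows "\<exists>c. c \<noteq> 0 \<and> D dvd pcompose c h"
proof -
  have "coeff (h ^ i mod D) k = 0" if "degree D \<le> k" for i k
    using degree_mod_less[OF assms, of "h ^ i"] that by (auto simp: coeff_eq_0)
  then obtain c where c: "\<exists>i\<in>{..degree D}. c i \<noteq> 0" "(\<Sum>i\<le>degree D. smult (c i) (h ^ i mod D)) = 0"
    using poly_family_dependent[of "{..degree D}" "degree D" "\<lambda>i. h ^ i mod D"] by auto
  define p where "p = (\<Sum>i\<le>degree D. monom (c i) i)"
  have "p \<noteq> 0"
  proof
    assume "p = 0"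
    then have "coeff p i = 0" for i by simp
    moreover have "coeff p i = c i" if "i \<le> degree D" for i
      using that by (simp add: p_def coeff_sum)
    ultimately show False using c(1) by auto
  qed
  moreover have "D dvd pcompose p h"
  proof -
    have "pcompose p h = (\<Sum>i\<le>degree D. smult (c i) (h ^ i - h ^ i mod D))"
      using c(2) by (simp add: p_def pcompose_poly_altdef smult_diff_right sum_subtractf)
    then show ?thesis by (auto intro!: dvd_sum dvd_smult dvd_minus_mod)
  qed
  ultimately show ?thesis by blast
qed

text \<open>Division with remainder, where the divisor in each degree from \<open>L\<close> on is
  taken from \<open>V\<close>. In effect, \<open>V\<close> has codimension at most
  \<open>L\<close>.\<close>

lemma reduce_modulo_subspace:
  fixes V :: "real poly set"
  assumes add: "\<And>p q. p \<in> V \<Longrightarrow> q \<in> V \<Longrightarrow> p + q \<in> V"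
    and smult: "\<And>a p. p \<in> V \<Longrightarrow> smult a p \<in> V"
    and deg: "\<And>k. L \<le> k \<Longrightarrow> \<exists>v\<in>V. v \<noteq> 0 \<and> degree v = k"
  shows "\<exists>v\<in>V. \<forall>k\<ge>L. coeff (p - v) k = 0"
proof (induction "degree p" arbitrary: p rule: less_induct)
  case less
  show ?case
  proof (cases "degree p < L")
    case True
    obtain v where "v \<in> V" using deg[of L] by auto
    then have "0 \<in> V" using smult[of v 0] by simp
    then show ?thesis using True by (intro bexI[of _ 0]) (auto simp: coeff_eq_0)
  next
    case False
    then obtain v where v: "v \<in> V" "v \<noteq> 0" "degree v = degree p" using deg[of "degree p"] by auto
    define w where "w = smult (lead_coeff p / lead_coeff v) v"
    have w: "w \<in> V" using smult v by (simp add: w_def)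
    have cw: "coeff (p - w) (degree p) = 0" using v by (simp add: w_def flip: v(3))
    \<comment> \<open>In degree 0, cancelling the leading coefficient leaves 0 but does not lower
      the degree, so the induction hypothesis cannot be applied.\<close>
    show ?thesis
    proof (cases "degree p = 0")
      case True
      then have "p - w = 0" using cw v by (intro poly_eqI) (metis coeff_0 coeff_eq_0 degree_diff_less le_degree degree_diff_le degree_smult_le w_def le_zero_eq order.refl zero_less_iff_neq_zero gr0I)
      then show ?thesis using w by auto
    next
      case False
      have "degree (p - w) < degree p" 
      proof -
        have "degree (p - w) \<le> degree p" by (intro degree_diff_le) (auto simp: w_def v)
        moreover have "degree (p - w) \<noteq> degree p"
          using cw False by (metis leading_coeff_0_iff degree_0)
        ultimately show ?thesis by simp
      qed
      then obtain v' where "v' \<in> V" "\<forall>k\<ge>L. coeff (p - w - v') k = 0" using less by blast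
      then show ?thesis using add[OF w] by (intro bexI[of _ "w + v'"]) (auto simp: algebra_simps)
    qed
  qed
qed

text \<open>Since \<open>degree f\<close> is 2 modulo \<open>degree h\<close>, the products
  \<open>h ^ i * f ^ j\<close> reach every large even degree, and a further factor x reaches the odd
  ones. The conclusion says that x is at most quadratic over the fraction field of the algebra
  \<open>W\<close>.\<close>

lemma invariants_quadratic_relation:
  fixes W :: "real poly set"
  assumes add: "\<And>p q. p \<in> W \<Longrightarrow> q \<in> W \<Longrightarrow> p + q \<in> W"
    and mult: "\<And>p q. p \<in> W \<Longrightarrow> q \<in> W \<Longrightarrow> p * q \<in> W"
    and const: "\<And>a. [:a:] \<in> W"
    and h: "h \<in> W" "degree h = 2 * m" "m > 0"
    and f: "f \<in> W" "degree f = 2 * m * e + 2"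
  shows "\<exists>c a b. c \<noteq> 0 \<and> a \<in> W \<and> b \<in> W \<and> [:0, 1:] ^ 2 * pcompose c h = a + [:0, 1:] * b"
proof -
  \<comment> \<open>\<open>V\<close> contains polynomials of every large degree, so the \<open>x\<^sup>2 h\<^sup>i\<close> are linearly dependent modulo \<open>V\<close>.\<close>
  define V where "V = {a + [:0, 1:] * b | a b. a \<in> W \<and> b \<in> W}"
  have pow: "p ^ i \<in> W" if "p \<in> W" for p i
    using that by (induction i) (auto intro: mult simp: const[of 1, folded one_pCons])
  have smult: "smult a p \<in> W" if "p \<in> W" for a p
    using mult[OF const[of a] that] by simp
  have zero: "0 \<in> W" using const[of 0] by simp
  have nz: "h \<noteq> 0" "f \<noteq> 0" using h f by auto
  have even_deg: "\<exists>w\<in>W. w \<noteq> 0 \<and> degree w = 2 * k" if "m * (m * e) \<le> k" for k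
  proof -
    \<comment> \<open>These solve \<open>2 * m * i + (2 * m * e + 2) * j = 2 * k\<close>. The lower
      bound on \<open>k\<close> keeps the subtraction in \<open>i\<close> from truncating, because
      \<open>j \<le> m\<close>.\<close>
    define j where "j = k mod m"
    define i where "i = k div m - j * e"
    have "m * (m * e) div m \<le> k div m" using that by (rule div_le_mono)
    then have "m * e \<le> k div m" using h by simp
    moreover have "j \<le> m" using h by (simp add: j_def)
    ultimately have "j * e \<le> k div m" by (meson le_trans mult_le_mono1)
    then have "i + j * e = k div m" by (simp add: i_def)
    then have "m * (i + j * e) + j = k" by (simp add: j_def)
    then have "degree (h ^ i * f ^ j) = 2 * k"
      using nz by (simp add: degree_mult_eq degree_power_eq h f algebra_simps)
    then show ?thesis using nz by (intro bexI[of _ "h ^ i * f ^ j"]) (auto intro: mult pow h f)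
  qed
  define L where "L = 2 * (m * (m * e)) + 1"
  have V_add: "p + q \<in> V" if "p \<in> V" "q \<in> V" for p q
  proof -
    obtain a b a' b' where "p = a + [:0, 1:] * b" "q = a' + [:0, 1:] * b'" "{a, b, a', b'} \<subseteq> W"
      using \<open>p \<in> V\<close> \<open>q \<in> V\<close> unfolding V_def by blast
    then have "p + q = (a + a') + [:0, 1:] * (b + b')" "a + a' \<in> W" "b + b' \<in> W"
      by (auto simp: algebra_simps intro: add)
    then show ?thesis unfolding V_def by blast
  qed
  have V_smult: "smult c p \<in> V" if "p \<in> V" for c p
  proof -
    obtain a b where "p = a + [:0, 1:] * b" "{a, b} \<subseteq> W" using \<open>p \<in> V\<close> unfolding V_def by blast
    then have "smult c p = smult c a + [:0, 1:] * smult c b" "smult c a \<in> W" "smult c b \<in> W"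
      by (auto simp: smult_add_right intro: smult)
    then show ?thesis unfolding V_def by blast
  qed
  have V_deg: "\<exists>v\<in>V. v \<noteq> 0 \<and> degree v = k" if "L \<le> k" for k
  proof -
    have k: "m * (m * e) \<le> k div 2" using that unfolding L_def by linarith
    show ?thesis
    proof (cases "even k")
      case True
      then obtain w where "w \<in> W" "w \<noteq> 0" "degree w = k"
        using even_deg[of "k div 2", OF k] by auto
      moreover have "w = w + [:0, 1:] * 0" by simp
      ultimately show ?thesis unfolding V_def using zero by blast
    next
      case False
      then obtain w where w: "w \<in> W" "w \<noteq> 0" "degree w = k - 1"
        using even_deg[of "k div 2", OF k] by (auto elim!: oddE)
      have "k > 0" using that by (simp add: L_def)
      then have "0 + [:0, 1:] * w \<noteq> 0" "degree (0 + [:0, 1:] * w) = k" using w by auto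
      then show ?thesis unfolding V_def using zero w by blast
    qed
  qed
  have "\<exists>v\<in>V. \<forall>k\<ge>L. coeff ([:0, 1:] ^ 2 * h ^ i - v) k = 0" for i
    by (rule reduce_modulo_subspace[OF V_add V_smult V_deg])
  then obtain v where v: "\<And>i. v i \<in> V" "\<And>i k. L \<le> k \<Longrightarrow> coeff ([:0, 1:] ^ 2 * h ^ i - v i) k = 0"
    by metis
  then obtain c where c: "\<exists>i\<in>{..L}. c i \<noteq> 0"
    "(\<Sum>i\<le>L. smult (c i) ([:0, 1:] ^ 2 * h ^ i - v i)) = 0"
    using poly_family_dependent[of "{..L}" L "\<lambda>i. [:0, 1:] ^ 2 * h ^ i - v i"] by auto
  define p where "p = (\<Sum>i\<le>L. monom (c i) i)"
  have "coeff p i = c i" if "i \<le> L" for i using that by (simp add: p_def coeff_sum)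
  then have "p \<noteq> 0" using c(1) by (metis atMost_iff coeff_0)
  have "[:0, 1:] ^ 2 * pcompose p h = (\<Sum>i\<le>L. smult (c i) (v i))"
    using c(2) by (simp add: p_def pcompose_poly_altdef smult_diff_right sum_subtractf sum_distrib_left
        del: mult_pCons_left)
  also have "\<dots> \<in> V"
  proof -
    have "0 \<in> V" using V_smult[of "v 0" 0] v by simp
    then have "(\<Sum>i\<in>A. smult (c i) (v i)) \<in> V" for A
      by (induction A rule: infinite_finite_induct) (auto intro: V_add V_smult v)
    then show ?thesis by simp
  qed
  finally show ?thesis using \<open>p \<noteq> 0\<close> unfolding V_def by blast
qed

lemma eventually_poly_nonzero:
  fixes p :: "real poly"
  assumes "p \<noteq> 0" "filterlim s at_infinity F"
  shows "\<forall>\<^sub>F y in F. poly p (s y) \<noteq> 0"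
proof -
  have "bounded {x. poly p x = 0}" using assms(1) poly_roots_finite finite_imp_bounded by blast
  then obtain B where "\<And>x. poly p x = 0 \<Longrightarrow> norm x \<le> B" unfolding bounded_iff by blast
  then have "\<forall>\<^sub>F x in at_infinity. poly p x \<noteq> 0"
    unfolding eventually_at_infinity by (metis add_le_same_cancel1 not_one_le_zero order_trans)
  then show ?thesis using assms(2) by (rule eventually_compose_filterlim)
qed

lemma poly_eq_if_eventually_eq:
  fixes p q :: "real poly"
  assumes "\<forall>\<^sub>F y in F. poly p (s y) = poly q (s y)" "filterlim s at_infinity F" "F \<noteq> bot"
  shows "p = q"
proof (rule ccontr)
  assume "p \<noteq> q"
  then have "\<forall>\<^sub>F y in F. poly (p - q) (s y) \<noteq> 0" by (intro eventually_poly_nonzero assms) auto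
  with assms(1) have "\<forall>\<^sub>F y in F. False" by eventually_elim auto
  then show False using assms(3) by simp
qed

text \<open>Here \<open>s\<close> and \<open>t\<close> play the two points of the fibre of
  \<open>h\<close> over a large value. By the degree condition \<open>N / D\<close> grows with
  exponent \<open>2 - degree h\<close>, so \<open>h * N / D\<close> has exponent 2; once its
  denominator is cleared, it is the second generator required for the quadratic relation.\<close>

lemma rational_conjugate_is_reflection:
  fixes s t :: "'y \<Rightarrow> real" and h N D :: "real poly"
  assumes F: "F \<noteq> bot" and s: "filterlim s at_top F" and t: "filterlim t at_bot F"
    and h: "degree h = 2 * m" "m > 0"
    and hst: "\<forall>\<^sub>F y in F. poly h (s y) = poly h (t y)"
    and ND: "N \<noteq> 0" "D \<noteq> 0" "degree N + degree h = degree D + 2"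
    and NDst: "\<forall>\<^sub>F y in F. poly N (s y) * poly D (t y) = poly N (t y) * poly D (s y)"
  shows "\<exists>c. \<forall>\<^sub>F y in F. s y + t y = c"
proof -
  have s_inf: "filterlim s at_infinity F" and t_inf: "filterlim t at_infinity F"
    using s t filterlim_at_top_imp_at_infinity filterlim_at_bot_imp_at_infinity by blast+
  have h0: "h \<noteq> 0" "degree h > 0" using h by auto
  define W where "W = {f. \<forall>\<^sub>F y in F. poly f (s y) = poly f (t y)}"
  have W_add: "p + q \<in> W" if "p \<in> W" "q \<in> W" for p q
    using that unfolding W_def mem_Collect_eq by eventually_elim simp
  have W_mult: "p * q \<in> W" if "p \<in> W" "q \<in> W" for p q
    using that unfolding W_def mem_Collect_eq by eventually_elim simp
  have W_const: "[:a:] \<in> W" for a by (simp add: W_def)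
  have W_h: "h \<in> W" using hst by (simp add: W_def)
  have compose_nz: "pcompose c h \<noteq> 0" if "c \<noteq> 0" for c
    using pcompose_eq_0[of c h] that h0 by auto
  \<comment> \<open>A multiple of \<open>D\<close> in \<open>\<real>[h]\<close> clears the denominator of the invariant function \<open>N / D\<close>.\<close>
  obtain c0 g where c0: "c0 \<noteq> 0" "pcompose c0 h = D * g"
    using dvd_pcompose_exists[OF ND(2), of h] unfolding dvd_def by blast
  then have g: "g \<noteq> 0" using compose_nz[of c0] by auto
  have "\<forall>\<^sub>F y in F. poly (g * N) (s y) = poly (g * N) (t y)"
    using hst NDst eventually_poly_nonzero[OF ND(2) s_inf] eventually_poly_nonzero[OF ND(2) t_inf]
  proof eventually_elim
    case (elim y)
    have "poly (D * g) (s y) = poly (D * g) (t y)"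
      using elim(1) by (simp add: poly_pcompose flip: c0(2))
    then have "poly D (s y) * poly g (s y) = poly D (t y) * poly g (t y)" by simp
    then have "(poly D (s y) * poly D (t y)) * (poly (g * N) (s y) - poly (g * N) (t y)) = 0"
      using elim(2) unfolding poly_mult by algebra
    then show ?case using elim by simp
  qed
  then have "g * N \<in> W" by (simp add: W_def)
  \<comment> \<open>The extra factor \<open>h\<close> raises the degree to
    \<open>degree h * degree c0 + 2\<close>, which is the required shape with
    \<open>e = degree c0\<close>.\<close>
  then have "h * (g * N) \<in> W" using W_h W_mult by blast
  moreover have "degree (h * (g * N)) = 2 * m * degree c0 + 2"
  proof -
    have "degree D + degree g = degree h * degree c0"
      using c0 g ND(2) by (simp add: degree_mult_eq mult.commute flip: degree_pcompose)
    then show ?thesis using g ND h0 h by (simp add: degree_mult_eq)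
  qed
  ultimately obtain c a b where rel: "c \<noteq> 0" "a \<in> W" "b \<in> W"
      "[:0, 1:] ^ 2 * pcompose c h = a + [:0, 1:] * b"
    using invariants_quadratic_relation[of W h m "h * (g * N)" "degree c0"] W_add W_mult W_const W_h h
    by blast
  define w where "w = pcompose c h"
  have w: "w \<noteq> 0" unfolding w_def by (rule compose_nz) fact
  have "w \<in> W" using hst by (simp add: W_def w_def poly_pcompose) (auto elim!: eventually_mono)
  have "\<forall>\<^sub>F y in F. s y > 0" "\<forall>\<^sub>F y in F. t y < 0"
    using s t by (auto simp: filterlim_at_top_dense filterlim_at_bot_dense)
  \<comment> \<open>Subtract the relation at \<open>t\<close> from the relation at \<open>s\<close>.
    As \<open>a\<close>, \<open>b\<close> and \<open>w\<close> take the same values at both points,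
    a factor \<open>s y - t y\<close> splits off, and it is nonzero because
    \<open>t y < 0 < s y\<close>.\<close>
  then have sum: "\<forall>\<^sub>F y in F. (s y + t y) * poly w (s y) = poly b (s y)"
    using rel(2,3)[unfolded W_def mem_Collect_eq] \<open>w \<in> W\<close>[unfolded W_def mem_Collect_eq]
  proof eventually_elim
    case (elim y)
    have rel': "x ^ 2 * poly w x = poly a x + x * poly b x" for x
      using arg_cong[OF rel(4), of "\<lambda>p. poly p x"] by (simp add: w_def)
    have "(s y - t y) * ((s y + t y) * poly w (s y) - poly b (s y)) = 0"
      using rel'[of "s y"] rel'[of "t y"] elim by (simp add: algebra_simps power2_eq_square)
    then show ?case using elim by auto
  qed
  define gg where "gg = gcd w b"
  have "gg \<noteq> 0" unfolding gg_def gcd_eq_0_iff using w by blast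
  then obtain D' N' where "w = D' * gg" "b = N' * gg" and cop: "coprime D' N'"
    using gcd_coprime_exists[of w b] unfolding gg_def by blast
  then have DN: "w = gg * D'" "b = gg * N'" by (simp_all only: mult.commute)
  \<comment> \<open>Now \<open>t = P(s) / D'(s)\<close> in lowest terms, and \<open>h(t) = h(s)\<close> makes \<open>D'\<close> constant as in the rational root theorem.\<close>
  define P where "P = N' - [:0, 1:] * D'"
  have nz: "gg \<noteq> 0" "D' \<noteq> 0" using w DN by auto
  have tP: "\<forall>\<^sub>F y in F. t y * poly D' (s y) = poly P (s y)"
    using sum eventually_poly_nonzero[OF nz(1) s_inf]
  proof eventually_elim
    case (elim y)
    have "(t y * poly D' (s y) - poly P (s y)) * poly gg (s y) = 0"
      using elim(1) by (simp add: DN P_def algebra_simps)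
    then show ?case using elim(2) by simp
  qed
  define n where "n = degree h"
  have "\<forall>\<^sub>F y in F. poly (h * D' ^ n) (s y)
      = poly (\<Sum>i\<le>n. smult (coeff h i) (P ^ i * D' ^ (n - i))) (s y)"
    using tP hst
  proof eventually_elim
    case (elim y)
    have "poly (h * D' ^ n) (s y) = (\<Sum>i\<le>n. coeff h i * t y ^ i * poly D' (s y) ^ n)"
      using elim by (simp add: poly_altdef[of h] n_def sum_distrib_right)
    also have "\<dots> = (\<Sum>i\<le>n. coeff h i * ((t y * poly D' (s y)) ^ i * poly D' (s y) ^ (n - i)))"
      by (intro sum.cong) (auto simp: power_mult_distrib simp flip: power_add)
    finally show ?case by (simp add: elim poly_sum)
  qed
  then have "h * D' ^ n = (\<Sum>i\<le>n. smult (coeff h i) (P ^ i * D' ^ (n - i)))"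
    using s_inf F by (rule poly_eq_if_eventually_eq)
  also have "\<dots> = smult (lead_coeff h) (P ^ n) + (\<Sum>i<n. smult (coeff h i) (P ^ i * D' ^ (n - i)))"
    by (simp add: n_def flip: lessThan_Suc_atMost)
  finally have "smult (lead_coeff h) (P ^ n)
      = h * D' ^ n - (\<Sum>i<n. smult (coeff h i) (P ^ i * D' ^ (n - i)))" by simp
  also have "D' dvd \<dots>"
    using h0 by (intro dvd_diff dvd_mult dvd_sum dvd_smult) (auto simp: n_def intro: dvd_power)
  finally have "D' dvd P ^ n" using h0 by (simp add: dvd_smult_iff)
  moreover have "coprime D' P"
  proof (rule coprimeI)
    fix e assume "e dvd D'" "e dvd P"
    then have "e dvd P + [:0, 1:] * D'" by (intro dvd_add dvd_mult)
    then have "e dvd N'" by (simp add: P_def)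
    with \<open>e dvd D'\<close> show "is_unit e" using cop coprime_common_divisor by blast
  qed
  ultimately have "is_unit D'" by (meson coprime_power_right_iff coprime_absorb_left)
  then obtain d where d: "D' = [:d:]" "d \<noteq> 0" using nz(2) by (auto simp: is_unit_poly_iff)
  define Lp where "Lp = smult (1 / d) P"
  have tL: "\<forall>\<^sub>F y in F. t y = poly Lp (s y)"
    using tP by eventually_elim (use d in \<open>auto simp: Lp_def field_simps\<close>)
  have "\<forall>\<^sub>F y in F. poly (pcompose h Lp) (s y) = poly h (s y)"
    using tL hst by eventually_elim (simp add: poly_pcompose)
  \<comment> \<open>Comparing degrees and leading coefficients in this identity makes
    \<open>Lp\<close> linear with slope 1 or -1.\<close>
  then have hL: "pcompose h Lp = h" using s_inf F by (rule poly_eq_if_eventually_eq)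
  then have "degree h * degree Lp = degree h" by (metis degree_pcompose)
  then have dL: "degree Lp = 1" using h0 by simp
  have "lead_coeff h * lead_coeff Lp ^ degree h = lead_coeff h"
    using lead_coeff_comp[of Lp h] dL hL by simp
  then have "\<bar>lead_coeff Lp\<bar> ^ degree h = 1" using h0 by (simp flip: power_abs)
  then have "\<bar>lead_coeff Lp\<bar> = 1"
    using power_eq_imp_eq_base[of "\<bar>lead_coeff Lp\<bar>" "degree h" 1] h0 by simp
  then have lc: "lead_coeff Lp = 1 \<or> lead_coeff Lp = -1" by linarith
  have L: "poly Lp x = coeff Lp 0 + lead_coeff Lp * x" for x
    using dL by (simp add: poly_altdef)
  \<comment> \<open>With slope 1, \<open>t\<close> would tend to plus infinity together with
    \<open>s\<close>.\<close>
  have "lead_coeff Lp \<noteq> 1"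
  proof
    assume "lead_coeff Lp = 1"
    then have "\<forall>\<^sub>F y in F. t y = coeff Lp 0 + s y" using tL L by (auto elim!: eventually_mono)
    moreover have "\<forall>\<^sub>F y in F. s y > - coeff Lp 0" "\<forall>\<^sub>F y in F. t y < 0"
      using s t by (auto simp: filterlim_at_top_dense filterlim_at_bot_dense)
    ultimately have "\<forall>\<^sub>F y in F. False" by eventually_elim auto
    then show False using F by simp
  qed
  then have "\<forall>\<^sub>F y in F. s y + t y = coeff Lp 0"
    using tL L lc by (auto elim!: eventually_mono)
  then show ?thesis ..
qed

section \<open>Gaussian integration by parts along a Stein chain\<close>

text \<open>A polynomial as majorant, rather than a constant times a power, makes closure under
  sums, products and substitution of \<open>h\<close> immediate.\<close>

definition poly_bounded :: "(real \<Rightarrow> real) \<Rightarrow> bool" where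
  "poly_bounded F \<longleftrightarrow> (\<exists>p. \<forall>x. \<bar>F x\<bar> \<le> poly p x)"

lemma poly_bounded_poly: "poly_bounded (poly p)"
  unfolding poly_bounded_def
proof (intro exI allI)
  fix x
  have "0 \<le> (\<bar>poly p x\<bar> - 1) ^ 2" by simp
  then show "\<bar>poly p x\<bar> \<le> poly (1 + p * p) x"
    using sum_squares_bound[of "\<bar>poly p x\<bar>" 1] by (simp add: power2_eq_square)
qed

lemma poly_bounded_const: "poly_bounded (\<lambda>x. c)"
  unfolding poly_bounded_def by (rule exI[of _ "[:\<bar>c\<bar>:]"]) simp

lemma poly_bounded_add: "poly_bounded F \<Longrightarrow> poly_bounded G \<Longrightarrow> poly_bounded (\<lambda>x. F x + G x)"
  unfolding poly_bounded_def
proof (elim exE)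
  fix p q assume "\<forall>x. \<bar>F x\<bar> \<le> poly p x" "\<forall>x. \<bar>G x\<bar> \<le> poly q x"
  then have "\<bar>F x + G x\<bar> \<le> poly (p + q) x" for x
    unfolding poly_add by (intro order_trans[OF abs_triangle_ineq] add_mono) auto
  then show "\<exists>p. \<forall>x. \<bar>F x + G x\<bar> \<le> poly p x" by blast
qed

lemma poly_bounded_minus: "poly_bounded F \<Longrightarrow> poly_bounded (\<lambda>x. - F x)"
  unfolding poly_bounded_def by simp

lemma poly_bounded_diff: "poly_bounded F \<Longrightarrow> poly_bounded G \<Longrightarrow> poly_bounded (\<lambda>x. F x - G x)"
  using poly_bounded_add[of F "\<lambda>x. - G x"] poly_bounded_minus by simp

lemma poly_bounded_mult: "poly_bounded F \<Longrightarrow> poly_bounded G \<Longrightarrow> poly_bounded (\<lambda>x. F x * G x)"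
  unfolding poly_bounded_def
proof (elim exE)
  fix p q assume "\<forall>x. \<bar>F x\<bar> \<le> poly p x" "\<forall>x. \<bar>G x\<bar> \<le> poly q x"
  then have "\<bar>F x * G x\<bar> \<le> poly (p * q) x" for x
    unfolding abs_mult poly_mult by (intro mult_mono) (auto intro: order_trans[OF abs_ge_zero])
  then show "\<exists>p. \<forall>x. \<bar>F x * G x\<bar> \<le> poly p x" by blast
qed

lemma poly_bounded_power: "poly_bounded F \<Longrightarrow> poly_bounded (\<lambda>x. F x ^ n)"
  by (induction n) (auto intro: poly_bounded_mult poly_bounded_const)

lemma poly_bounded_compose: "poly_bounded F \<Longrightarrow> poly_bounded (\<lambda>x. F (poly h x))"
  unfolding poly_bounded_def by (metis poly_pcompose)

lemma poly_bounded_mono: "poly_bounded G \<Longrightarrow> (\<And>x. \<bar>F x\<bar> \<le> \<bar>G x\<bar>) \<Longrightarrow> poly_bounded F"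
  unfolding poly_bounded_def by (meson order_trans)

lemmas poly_bounded_intros = poly_bounded_poly poly_bounded_const poly_bounded_add poly_bounded_minus
  poly_bounded_diff poly_bounded_mult poly_bounded_power

section \<open>Gaussian integrals of functions of polynomial growth\<close>

lemma borel_measurable_poly [measurable]:
  "f \<in> borel_measurable M \<Longrightarrow> (\<lambda>x. poly p (f x) :: real) \<in> borel_measurable M"
  by (induction p) auto

lemma integrable_std_normal_poly: "integrable lborel (\<lambda>x. std_normal_density x * poly p x)"
proof -
  have "integrable lborel (\<lambda>x. \<Sum>i\<le>degree p. coeff p i * (std_normal_density x * x ^ i))"
    by (intro Bochner_Integration.integrable_sum integrable_mult_right integrable_std_normal_moment)
  then show ?thesis by (simp add: poly_altdef sum_distrib_left mult.left_commute)
qed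

lemma integrable_std_normal_poly_bounded:
  assumes "poly_bounded g" and [measurable]: "g \<in> borel_measurable borel"
  shows "integrable lborel (\<lambda>x. std_normal_density x * g x)"
proof -
  obtain p where p: "\<And>x. \<bar>g x\<bar> \<le> poly p x" using assms unfolding poly_bounded_def by blast
  show ?thesis
  proof (rule Bochner_Integration.integrable_bound[OF integrable_std_normal_poly[of p]])
    have "\<bar>std_normal_density x * g x\<bar> \<le> \<bar>std_normal_density x * poly p x\<bar>" for x
      unfolding abs_mult using p[of x] by (intro mult_left_mono) auto
    then show "AE x in lborel. norm (std_normal_density x * g x) \<le> norm (std_normal_density x * poly p x)"
      by simp
  qed simp
qed

lemma tendsto_std_normal_poly: "((\<lambda>x. std_normal_density x * poly p x) \<longlongrightarrow> 0) at_infinity"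
proof -
  have "((\<lambda>x. std_normal_density x * x ^ i) \<longlongrightarrow> 0) at_infinity" for i
  proof (rule Lim_null_comparison)
    have "filterlim (\<lambda>x::real. \<bar>x\<bar>) at_top at_infinity"
      using filterlim_norm_at_top[where 'a = real] unfolding real_norm_def[abs_def] .
    then have "((\<lambda>x::real. \<bar>x\<bar> ^ i / exp \<bar>x\<bar>) \<longlongrightarrow> 0) at_infinity"
      by (rule filterlim_compose[OF tendsto_power_div_exp_0])
    from tendsto_mult_right_zero[OF this, of "exp (1/2)"]
    show "((\<lambda>x::real. exp (1/2) * (\<bar>x\<bar> ^ i / exp \<bar>x\<bar>)) \<longlongrightarrow> 0) at_infinity" .
    have "norm (std_normal_density x * x ^ i) \<le> exp (1/2) * (\<bar>x\<bar> ^ i / exp \<bar>x\<bar>)" for x :: real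
    proof -
      \<comment> \<open>Completing the square bounds the Gaussian by a multiple of exp(-|x|),
        against which every power is known to vanish at infinity.\<close>
      have "0 \<le> (\<bar>x\<bar> - 1) ^ 2" by simp
      then have "- x\<^sup>2 / 2 \<le> 1/2 - \<bar>x\<bar>" by (simp add: power2_diff)
      then have "exp (- x\<^sup>2 / 2) \<le> exp (1/2) / exp \<bar>x\<bar>" by (simp flip: exp_diff)
      moreover have "1 / sqrt (2 * pi) \<le> 1" using pi_ge_two by (simp add: real_le_rsqrt)
      ultimately have "std_normal_density x \<le> 1 * (exp (1/2) / exp \<bar>x\<bar>)"
        unfolding std_normal_density_def by (intro mult_mono) auto
      then show ?thesis
        using mult_right_mono[of "std_normal_density x" "exp (1/2) / exp \<bar>x\<bar>" "\<bar>x\<bar> ^ i"]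
        by (simp add: abs_mult power_abs)
    qed
    then show "\<forall>\<^sub>F x in at_infinity. norm (std_normal_density x * x ^ i) \<le> exp (1/2) * (\<bar>x\<bar> ^ i / exp \<bar>x\<bar>)"
      by simp
  qed
  then have "((\<lambda>x. \<Sum>i\<le>degree p. coeff p i * (std_normal_density x * x ^ i)) \<longlongrightarrow> 0) at_infinity"
    by (intro tendsto_null_sum tendsto_mult_right_zero)
  then show ?thesis by (simp add: poly_altdef sum_distrib_left mult.left_commute)
qed

lemma tendsto_std_normal_poly_bounded:
  assumes "poly_bounded g"
  shows "((\<lambda>x. std_normal_density x * g x) \<longlongrightarrow> 0) at_infinity"
proof -
  obtain p where "\<And>x. \<bar>g x\<bar> \<le> poly p x" using assms unfolding poly_bounded_def by blast
  then have "norm (std_normal_density x * g x) \<le> std_normal_density x * poly p x" for x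
    by (simp add: abs_mult mult_left_mono)
  then show ?thesis
    by (intro Lim_null_comparison[OF _ tendsto_std_normal_poly[of p]]) simp
qed

text \<open>The fundamental theorem on [-n, n] leaves only boundary terms, which tend to 0;
  dominated convergence gives the integral over the line. This is integration by parts without
  boundary terms.\<close>

lemma integral_derivative_eq_0:
  fixes F f :: "real \<Rightarrow> real"
  assumes F: "\<And>x. (F has_real_derivative f x) (at x)" and f: "continuous_on UNIV f" "integrable lborel f"
    and lim: "(F \<longlongrightarrow> 0) at_infinity"
  shows "(LINT x|lborel. f x) = 0"
proof (rule LIMSEQ_unique)
  have lim1: "(\<lambda>n. LINT x|lborel. f x * indicat_real {- real n..real n} x) \<longlonglongrightarrow> (LINT x|lborel. f x)"
  proof (rule integral_dominated_convergence[of _ _ _ "\<lambda>x. \<bar>f x\<bar>"])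
    have [measurable]: "f \<in> borel_measurable borel"
      using f(1) by (rule borel_measurable_continuous_onI)
    show "f \<in> borel_measurable lborel" by simp
    show "(\<lambda>x. f x * indicat_real {- real n..real n} x) \<in> borel_measurable lborel" for n by simp
    show "AE x in lborel. (\<lambda>n. f x * indicat_real {- real n..real n} x) \<longlonglongrightarrow> f x"
    proof (rule AE_I2)
      fix x :: real
      obtain N :: nat where "\<bar>x\<bar> \<le> real N" using real_arch_simple[of "\<bar>x\<bar>"] by blast
      then have "\<forall>\<^sub>F n in sequentially. f x = f x * indicat_real {- real n..real n} x"
        by (intro eventually_sequentiallyI[of N]) (auto simp: abs_le_iff indicator_def)
      then have "\<forall>\<^sub>F n in sequentially. f x * indicat_real {- real n..real n} x = f x"
        by eventually_elim (rule sym)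
      then show "(\<lambda>n. f x * indicat_real {- real n..real n} x) \<longlonglongrightarrow> f x"
        by (rule tendsto_eventually)
    qed
  qed (use f in \<open>auto simp: indicator_def\<close>)
  have eq: "(LINT x|lborel. f x * indicat_real {- real n..real n} x) = F n - F (- n)" for n
    using f(1) by (intro integral_FTC_Icc_real F) (auto simp: continuous_on_eq_continuous_at)
  show "(\<lambda>n. F (real n) - F (- real n)) \<longlonglongrightarrow> (LINT x|lborel. f x)"
    using lim1 unfolding eq .
  have "filterlim (\<lambda>n. real n) at_infinity sequentially" "filterlim (\<lambda>n. - real n) at_infinity sequentially"
    using filterlim_real_sequentially
    by (auto intro: filterlim_at_top_imp_at_infinity filterlim_at_bot_imp_at_infinity simp: filterlim_uminus_at_bot)
  then have "(\<lambda>n. F (real n) - F (- real n)) \<longlonglongrightarrow> 0 - 0"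
    by (intro tendsto_diff filterlim_compose[OF lim])
  then show "(\<lambda>n. F (real n) - F (- real n)) \<longlonglongrightarrow> 0" by simp
qed

abbreviation gauss :: "(real \<Rightarrow> real) \<Rightarrow> real" where
  "gauss g \<equiv> (LINT x|lborel. std_normal_density x * g x)"

text \<open>A test function is carried together with its first \<open>T\<close> derivatives on the
  whole line. Derivatives within the support of \<open>Y\<close> are thereby postponed until the
  identities are applied to random variables.\<close>

definition smooth_tower :: "nat \<Rightarrow> (nat \<Rightarrow> real \<Rightarrow> real) \<Rightarrow> bool" where
  "smooth_tower T D \<longleftrightarrow> (\<forall>t<T. \<forall>y. (D t has_real_derivative D (Suc t) y) (at y)) \<and>
     (\<forall>t\<le>T. continuous_on UNIV (D t) \<and> poly_bounded (D t))"

lemma DERIV_std_normal_density: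
  "(std_normal_density has_real_derivative - x * std_normal_density x) (at x)"
proof -
  have "((\<lambda>x. c * exp (- x\<^sup>2 / 2)) has_real_derivative - x * (c * exp (- x\<^sup>2 / 2))) (at x)" for c :: real
    by (auto intro!: derivative_eq_intros)
  then show ?thesis unfolding std_normal_density_def[abs_def] .
qed

text \<open>Because the density satisfies \<open>\<phi>' = - x \<phi>\<close>, the difference of the
  two integrands, with the density included, is the derivative of \<open>\<phi> u F(h)\<close>,
  which vanishes at infinity.\<close>

lemma gauss_ibp:
  assumes F: "\<And>y. (F has_real_derivative F' y) (at y)" and F': "continuous_on UNIV F'"
    and pb: "poly_bounded F" "poly_bounded F'"
  shows "gauss (\<lambda>x. (x * poly u x - poly (pderiv u) x) * F (poly h x))
       = gauss (\<lambda>x. poly (pderiv h * u) x * F' (poly h x))"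
proof -
  have cF: "continuous_on UNIV F" using F DERIV_continuous_on by (metis has_field_derivative_at_within)
  have [measurable]: "F \<in> borel_measurable borel" "F' \<in> borel_measurable borel"
    using cF F' by (auto intro: borel_measurable_continuous_onI)
  define a where "a x = (x * poly u x - poly (pderiv u) x) * F (poly h x)" for x
  define b where "b x = poly (pderiv h * u) x * F' (poly h x)" for x
  have "poly_bounded (\<lambda>x. poly ([:0, 1:] * u - pderiv u) x * F (poly h x))"
    by (intro poly_bounded_intros poly_bounded_compose[OF pb(1)] poly_bounded_compose[OF pb(2)])
  then have pa: "poly_bounded a" by (simp add: a_def[abs_def])
  have pbb: "poly_bounded b" unfolding b_def by (intro poly_bounded_intros poly_bounded_compose[OF pb(1)] poly_bounded_compose[OF pb(2)])
  have [measurable]: "a \<in> borel_measurable borel" "b \<in> borel_measurable borel"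
    unfolding a_def[abs_def] b_def[abs_def] by measurable
  have int: "integrable lborel (\<lambda>x. std_normal_density x * a x)"
            "integrable lborel (\<lambda>x. std_normal_density x * b x)"
    by (rule integrable_std_normal_poly_bounded; fact)+
  have "(LINT x|lborel. std_normal_density x * b x - std_normal_density x * a x) = 0"
  proof (rule integral_derivative_eq_0)
    show "((\<lambda>x. std_normal_density x * (poly u x * F (poly h x))) has_real_derivative
        std_normal_density x * b x - std_normal_density x * a x) (at x)" for x
      by (rule DERIV_cong, rule DERIV_mult[OF DERIV_std_normal_density DERIV_mult[OF poly_DERIV DERIV_chain2[OF F poly_DERIV]]])
        (simp add: a_def b_def algebra_simps)
    show "continuous_on UNIV (\<lambda>x. std_normal_density x * b x - std_normal_density x * a x)"
      unfolding a_def b_def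
      by (intro continuous_on_diff continuous_on_mult continuous_on_poly continuous_on_id
          continuous_on_compose2[OF cF] continuous_on_compose2[OF F'] DERIV_continuous_on[OF
          has_field_derivative_at_within[OF DERIV_std_normal_density]]) auto
    show "((\<lambda>x. std_normal_density x * (poly u x * F (poly h x))) \<longlongrightarrow> 0) at_infinity"
      by (intro tendsto_std_normal_poly_bounded poly_bounded_intros poly_bounded_compose[OF pb(1)] poly_bounded_compose[OF pb(2)])
    show "integrable lborel (\<lambda>x. std_normal_density x * b x - std_normal_density x * a x)"
      by (intro Bochner_Integration.integrable_diff int)
  qed
  then have "gauss b - gauss a = 0"
    by (simp only: Bochner_Integration.integral_diff[OF int(2,1)])
  then have "gauss a = gauss b" by simp
  then show ?thesis unfolding a_def b_def .
qed

lemma smooth_tower_Suc: "smooth_tower (Suc T) D \<Longrightarrow> smooth_tower T D"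
  by (auto simp: smooth_tower_def)

lemma smooth_tower_measurable: "smooth_tower T D \<Longrightarrow> t \<le> T \<Longrightarrow> D t \<in> borel_measurable borel"
  by (auto simp: smooth_tower_def intro: borel_measurable_continuous_onI)

lemma integrable_std_normal_tower:
  assumes "smooth_tower T D" "t \<le> T"
  shows "integrable lborel (\<lambda>x. std_normal_density x * (poly p x * D t (poly h x)))"
proof (rule integrable_std_normal_poly_bounded)
  have [measurable]: "D t \<in> borel_measurable borel" using assms by (rule smooth_tower_measurable)
  show "(\<lambda>x. poly p x * D t (poly h x)) \<in> borel_measurable borel" by measurable
  have "poly_bounded (D t)" using assms by (auto simp: smooth_tower_def)
  then show "poly_bounded (\<lambda>x. poly p x * D t (poly h x))"
    by (intro poly_bounded_mult poly_bounded_poly poly_bounded_compose)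
qed

text \<open>Induction on \<open>T\<close>: the constant part of \<open>q T\<close> contributes the
  summand with \<open>c T\<close>, the rest moves by parts onto the next derivative, where it
  combines with the term of \<open>p (Suc T)\<close> into \<open>q (Suc T)\<close>.\<close>

lemma gauss_stein_chain:
  assumes D: "smooth_tower T D"
    and q0: "q 0 = pcompose (p 0) h"
    and q: "\<And>t. t < T \<Longrightarrow> q t = [:c t:] + [:0, 1:] * u t - pderiv (u t)"
    and qS: "\<And>t. t < T \<Longrightarrow> q (Suc t) = pderiv h * u t + pcompose (p (Suc t)) h"
  shows "gauss (\<lambda>x. \<Sum>t\<le>T. poly (p t) (poly h x) * D t (poly h x))
     = (\<Sum>t<T. c t * gauss (\<lambda>x. D t (poly h x))) + gauss (\<lambda>x. poly (q T) x * D T (poly h x))"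
  using D q qS
proof (induction T)
  case 0
  then show ?case by (simp add: q0 poly_pcompose)
next
  case (Suc T)
  note D = Suc.prems(1)
  note int = integrable_std_normal_tower[OF D]
  define S where "S x = (\<Sum>t\<le>T. poly (p t) (poly h x) * D t (poly h x))" for x
  define P where "P x = poly (p (Suc T)) (poly h x) * D (Suc T) (poly h x)" for x
  have intS: "integrable lborel (\<lambda>x. std_normal_density x * S x)"
    unfolding S_def sum_distrib_left
    using int[of _ "pcompose (p _) h" h] by (intro Bochner_Integration.integrable_sum) (simp add: poly_pcompose)
  have intP: "integrable lborel (\<lambda>x. std_normal_density x * P x)"
    unfolding P_def using int[of "Suc T" "pcompose (p (Suc T)) h" h] by (simp add: poly_pcompose)
  have ibp: "gauss (\<lambda>x. (x * poly (u T) x - poly (pderiv (u T)) x) * D T (poly h x))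
      = gauss (\<lambda>x. poly (pderiv h * u T) x * D (Suc T) (poly h x))"
    using D by (intro gauss_ibp) (auto simp: smooth_tower_def)
  have int1: "integrable lborel (\<lambda>x. std_normal_density x * ((x * poly (u T) x - poly (pderiv (u T)) x) * D T (poly h x)))"
    using int[of T "[:0, 1:] * u T - pderiv (u T)" h] by simp
  have int2: "integrable lborel (\<lambda>x. c T * (std_normal_density x * D T (poly h x)))"
    using int[of T "[:c T:]" h] by (simp add: algebra_simps)
  have int3: "integrable lborel (\<lambda>x. std_normal_density x * (poly (pderiv h * u T) x * D (Suc T) (poly h x)))"
    by (rule int) simp
  have qT: "gauss (\<lambda>x. poly (q T) x * D T (poly h x))
      = c T * gauss (\<lambda>x. D T (poly h x)) + gauss (\<lambda>x. poly (pderiv h * u T) x * D (Suc T) (poly h x))"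
  proof -
    have "gauss (\<lambda>x. poly (q T) x * D T (poly h x)) = (LINT x|lborel. c T * (std_normal_density x * D T (poly h x))
        + std_normal_density x * ((x * poly (u T) x - poly (pderiv (u T)) x) * D T (poly h x)))"
      by (rule Bochner_Integration.integral_cong[OF refl]) (simp add: Suc.prems(2) algebra_simps)
    then show ?thesis
      using ibp by (simp only: Bochner_Integration.integral_add[OF int2 int1] integral_mult_right_zero)
  qed
  have qS: "gauss (\<lambda>x. poly (q (Suc T)) x * D (Suc T) (poly h x))
      = gauss (\<lambda>x. poly (pderiv h * u T) x * D (Suc T) (poly h x)) + gauss P"
  proof -
    have "gauss (\<lambda>x. poly (q (Suc T)) x * D (Suc T) (poly h x))
      = (LINT x|lborel. std_normal_density x * (poly (pderiv h * u T) x * D (Suc T) (poly h x)) + std_normal_density x * P x)"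
      by (rule Bochner_Integration.integral_cong[OF refl])
        (simp add: Suc.prems(3) poly_pcompose P_def algebra_simps)
    then show ?thesis by (simp only: Bochner_Integration.integral_add[OF int3 intP])
  qed
  have "gauss (\<lambda>x. \<Sum>t\<le>Suc T. poly (p t) (poly h x) * D t (poly h x))
      = (LINT x|lborel. std_normal_density x * S x + std_normal_density x * P x)"
    by (simp add: S_def P_def distrib_left)
  also have "\<dots> = gauss S + gauss P"
    by (rule Bochner_Integration.integral_add[OF intS intP])
  also have "gauss S = (\<Sum>t<T. c t * gauss (\<lambda>x. D t (poly h x))) + gauss (\<lambda>x. poly (q T) x * D T (poly h x))"
    unfolding S_def
    by (rule Suc.IH[OF smooth_tower_Suc[OF D] Suc.prems(2)[OF less_SucI] Suc.prems(3)[OF less_SucI]])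
  finally show ?case using qT qS by simp
qed

lemma gauss_1: "gauss (\<lambda>x. 1) = 1"
  using integral_std_normal_moment_even[of 0] by simp

section \<open>Test functions: monomials and truncated powers\<close>

lemma DERIV_power_div_fact:
  "((\<lambda>y::real. y ^ Suc n / fact (Suc n)) has_real_derivative y ^ n / fact n) (at y)"
  by (rule DERIV_cong, rule DERIV_cdivide, rule DERIV_pow) (simp add: fact_Suc del: of_nat_Suc)

text \<open>These are the derivatives of y^k / k!, normalised so that the \<open>k\<close>-th one is
  the constant 1.\<close>

lemma smooth_tower_monomial:
  "smooth_tower T (\<lambda>t y. if t \<le> k then y ^ (k - t) / fact (k - t) else 0)"
  unfolding smooth_tower_def
proof (intro conjI allI impI)
  fix t and y :: real
  show "((\<lambda>y. if t \<le> k then y ^ (k - t) / fact (k - t) else 0) has_real_derivative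
      (if Suc t \<le> k then y ^ (k - Suc t) / fact (k - Suc t) else 0)) (at y)"
  proof (cases "Suc t \<le> k")
    case True
    then have "k - t = Suc (k - Suc t)" by simp
    then show ?thesis using DERIV_power_div_fact[of "k - Suc t" y] True by auto
  next
    case False
    then show ?thesis by (cases "t = k") auto
  qed
next
  fix t
  show "continuous_on UNIV (\<lambda>y::real. if t \<le> k then y ^ (k - t) / fact (k - t) else 0)"
    by (cases "t \<le> k") (auto intro!: continuous_intros)
  have "poly_bounded (poly (if t \<le> k then monom (1 / fact (k - t)) (k - t) else 0))"
    by (rule poly_bounded_poly)
  moreover have "poly (if t \<le> k then monom (1 / fact (k - t)) (k - t) else 0)
      = (\<lambda>y::real. if t \<le> k then y ^ (k - t) / fact (k - t) else 0)"
    by (auto simp: poly_monom)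
  ultimately show "poly_bounded (\<lambda>y. if t \<le> k then y ^ (k - t) / fact (k - t) else 0)" by simp
qed

lemma DERIV_ramp_power:
  "((\<lambda>y. max 0 (y - a) ^ Suc (Suc n)) has_real_derivative real (Suc (Suc n)) * max 0 (y - a) ^ Suc n) (at y)"
proof -
  consider "y > a" | "y < a" | "y = a" by linarith
  then show ?thesis
  proof cases
    case 1
    have "((\<lambda>y. (y - a) ^ Suc (Suc n)) has_real_derivative real (Suc (Suc n)) * (y - a) ^ Suc n) (at y)"
      by (rule DERIV_cong, rule DERIV_fun_pow[where m = 1]) (auto intro!: derivative_eq_intros simp del: power_Suc)
    then have "((\<lambda>y. max 0 (y - a) ^ Suc (Suc n)) has_real_derivative real (Suc (Suc n)) * (y - a) ^ Suc n) (at y)"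
      by (rule has_field_derivative_transform_within_open[of _ _ _ "{a<..}"]) (use 1 in auto)
    then show ?thesis using 1 by simp
  next
    case 2
    have "((\<lambda>y. 0) has_real_derivative 0) (at y)" by simp
    then have "((\<lambda>y. max 0 (y - a) ^ Suc (Suc n)) has_real_derivative 0) (at y)"
      by (rule has_field_derivative_transform_within_open[of _ _ _ "{..<a}"]) (use 2 in auto)
    then show ?thesis using 2 by simp
  next
    case 3
    \<comment> \<open>At the kink the difference quotient is 0 on the left and a positive power of
      \<open>h\<close> on the right; the exponent of the ramp is at least 2.\<close>
    have "((\<lambda>h. (max 0 (y + h - a) ^ Suc (Suc n) - max 0 (y - a) ^ Suc (Suc n)) / h) \<longlongrightarrow> 0) (at 0)"
    proof (rule Lim_null_comparison)
      show "((\<lambda>h::real. \<bar>h\<bar> ^ Suc n) \<longlongrightarrow> 0) (at 0)" by (auto intro!: tendsto_eq_intros)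
      show "\<forall>\<^sub>F h in at 0. norm ((max 0 (y + h - a) ^ Suc (Suc n) - max 0 (y - a) ^ Suc (Suc n)) / h) \<le> \<bar>h\<bar> ^ Suc n"
      proof (rule always_eventually, rule allI)
        fix h :: real
        show "norm ((max 0 (y + h - a) ^ Suc (Suc n) - max 0 (y - a) ^ Suc (Suc n)) / h) \<le> \<bar>h\<bar> ^ Suc n"
          by (cases "h > 0") (simp add: 3, simp add: 3 del: power_Suc)
      qed
    qed
    then show ?thesis using 3 by (simp add: DERIV_def)
  qed
qed

text \<open>The exponent \<open>T + 1\<close> is chosen so that the \<open>T\<close>-th derivative
  is the ramp itself, which is continuous though not differentiable at \<open>a\<close>.\<close>

lemma smooth_tower_ramp:
  "smooth_tower T (\<lambda>t y. max 0 (y - a) ^ (Suc T - t) / fact (Suc T - t))"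
  unfolding smooth_tower_def
proof (intro conjI allI impI)
  fix t y assume "t < T"
  then obtain n where n: "Suc T - t = Suc (Suc n)" "Suc T - Suc t = Suc n"
    by (metis Suc_diff_Suc Suc_diff_le less_imp_le diff_Suc_Suc)
  show "((\<lambda>y. max 0 (y - a) ^ (Suc T - t) / fact (Suc T - t)) has_real_derivative
      max 0 (y - a) ^ (Suc T - Suc t) / fact (Suc T - Suc t)) (at y)"
    unfolding n
    by (rule DERIV_cong, rule DERIV_cdivide, rule DERIV_ramp_power) (simp add: fact_Suc del: power_Suc of_nat_Suc)
next
  fix t
  show "continuous_on UNIV (\<lambda>y. max 0 (y - a) ^ (Suc T - t) / fact (Suc T - t))"
    by (intro continuous_intros) auto
  have "poly_bounded (\<lambda>y. max 0 (y - a))"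
    by (rule poly_bounded_mono[OF poly_bounded_poly[of "[:-a, 1:]"]]) auto
  from poly_bounded_mult[OF poly_bounded_power[OF this] poly_bounded_const[of "1 / fact (Suc T - t)"]]
  show "poly_bounded (\<lambda>y. max 0 (y - a) ^ (Suc T - t) / fact (Suc T - t))" by simp
qed

lemma gauss_stein_chain_tests:
  assumes q0: "q 0 = pcompose (p 0) h"
    and q: "\<And>t. t < T \<Longrightarrow> q t = [:c t:] + [:0, 1:] * u t - pderiv (u t)"
    and qS: "\<And>t. t < T \<Longrightarrow> q (Suc t) = pderiv h * u t + pcompose (p (Suc t)) h"
    and H: "\<And>D. smooth_tower T D \<Longrightarrow>
      gauss (\<lambda>x. \<Sum>t\<le>T. poly (p t) (poly h x) * D t (poly h x)) = 0"
  shows "t \<le> T \<Longrightarrow> gauss (poly (q t)) = 0"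
    and "gauss (\<lambda>x. poly (q T) x * max 0 (poly h x - a)) = 0"
proof -
  have key: "(\<Sum>t<T. c t * gauss (\<lambda>x. D t (poly h x))) + gauss (\<lambda>x. poly (q T) x * D T (poly h x)) = 0"
    if "smooth_tower T D" for D
    using gauss_stein_chain[where q = q and c = c, OF that q0 q qS] H[OF that] by simp
  \<comment> \<open>Test with the monomial of degree \<open>k < T\<close>: the earlier
    \<open>c t\<close> vanish by induction, the derivatives beyond the \<open>k\<close>-th
    (including the \<open>T\<close>-th) are 0, and the \<open>k\<close>-th is 1. Only
    \<open>c k\<close> is left.\<close>
  have c0: "c t = 0" if "t < T" for t
    using that
  proof (induction t rule: less_induct)
    case (less k)
    let ?D = "\<lambda>t y. if t \<le> k then y ^ (k - t) / fact (k - t) else 0 :: real"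
    have "c t * gauss (\<lambda>x. ?D t (poly h x)) = (if t = k then c k else 0)" if "t < T" for t
      using less that gauss_1 by (cases t k rule: linorder_cases) auto
    then have "(\<Sum>t<T. c t * gauss (\<lambda>x. ?D t (poly h x))) = (\<Sum>t<T. if t = k then c k else 0)"
      by (intro sum.cong) auto
    then show ?case using key[OF smooth_tower_monomial[of T k]] less.prems by simp
  qed
  have "gauss (poly (q T)) = 0"
    using key[OF smooth_tower_monomial[of T T]] c0 by simp
  \<comment> \<open>Integration by parts with \<open>F = 1\<close> shows that \<open>c t\<close> is
    the mean of \<open>q t\<close>.\<close>
  moreover have "gauss (poly (q t)) = 0" if "t < T"
    using gauss_ibp[of "\<lambda>_. 1" "\<lambda>_. 0" "u t"] c0[OF that] q[OF that] by (simp add: poly_bounded_const)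
  ultimately show "gauss (poly (q t)) = 0" if "t \<le> T"
    using that by (cases "t = T") auto
  show "gauss (\<lambda>x. poly (q T) x * max 0 (poly h x - a)) = 0"
    using key[OF smooth_tower_ramp[of T a]] c0 by simp
qed

lemma gauss_indicator_eq_0:
  assumes ramp: "\<And>a. gauss (\<lambda>x. poly q x * max 0 (poly h x - a)) = 0" and "a \<le> b"
  shows "gauss (\<lambda>x. poly q x * indicator {a..b} (poly h x)) = 0"
proof -
  \<comment> \<open>\<open>(n + 1) K n\<close> is a trapezoid converging pointwise to the indicator function.\<close>
  define K where "K n z = (max 0 (z - (a - 1 / Suc n)) - max 0 (z - a))
     - (max 0 (z - b) - max 0 (z - (b + 1 / Suc n)))" for n and z :: real
  have int: "integrable lborel (\<lambda>x. std_normal_density x * (poly q x * max 0 (poly h x - a)))" for a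
  proof (rule integrable_std_normal_poly_bounded)
    have "poly_bounded (\<lambda>y. max 0 (y - a))"
      by (rule poly_bounded_mono[OF poly_bounded_poly[of "[:-a, 1:]"]]) auto
    then show "poly_bounded (\<lambda>x. poly q x * max 0 (poly h x - a))"
      by (intro poly_bounded_mult poly_bounded_poly) (rule poly_bounded_compose)
  qed simp
  have "gauss (\<lambda>x. poly q x * (real (Suc n) * K n (poly h x))) = 0" for n
  proof -
    have "gauss (\<lambda>x. poly q x * (real (Suc n) * K n (poly h x))) = (LINT x|lborel. real (Suc n) *
       ((std_normal_density x * (poly q x * max 0 (poly h x - (a - 1 / Suc n)))
        - std_normal_density x * (poly q x * max 0 (poly h x - a)))
        - (std_normal_density x * (poly q x * max 0 (poly h x - b))
        - std_normal_density x * (poly q x * max 0 (poly h x - (b + 1 / Suc n))))))"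
      by (rule Bochner_Integration.integral_cong[OF refl]) (simp only: K_def algebra_simps)
    also have "\<dots> = real (Suc n) * (0 - 0 - (0 - 0))"
      by (simp only: integral_mult_right_zero ramp Bochner_Integration.integral_diff
          Bochner_Integration.integrable_diff int)
    also have "\<dots> = 0" by simp
    finally show ?thesis .
  qed
  moreover have "(\<lambda>n. gauss (\<lambda>x. poly q x * (real (Suc n) * K n (poly h x))))
      \<longlonglongrightarrow> gauss (\<lambda>x. poly q x * indicator {a..b} (poly h x))"
  proof (rule integral_dominated_convergence[of _ _ _ "\<lambda>x. std_normal_density x * \<bar>poly q x\<bar> * 2"])
    show "integrable lborel (\<lambda>x. std_normal_density x * \<bar>poly q x\<bar> * 2)"
      using integrable_std_normal_poly_bounded[of "\<lambda>x. \<bar>poly q x\<bar>"]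
        poly_bounded_mono[OF poly_bounded_poly[of q], of "\<lambda>x. \<bar>poly q x\<bar>"] by auto
    \<comment> \<open>The slopes of the trapezoid lie outside \<open>{a..b}\<close>, over the
      intervals of length \<open>1 / Suc n\<close> next to it, so the limit is 1 at both end points
      as well.\<close>
    have lim: "(\<lambda>n. real (Suc n) * K n z) \<longlonglongrightarrow> indicator {a..b} z" for z
    proof -
      define g where "g n = real (Suc n) * (max 0 (z - b) - max 0 (z - (b + 1 / Suc n)))" for n
      define f where "f n = real (Suc n) * (max 0 (z - (a - 1 / Suc n)) - max 0 (z - a))" for n
      have small: "\<forall>\<^sub>F n in sequentially. 1 / real (Suc n) < e" if "e > 0" for e
        using LIMSEQ_Suc[OF lim_1_over_n[where 'a = real]] that by (simp add: order_tendsto_iff)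
      have "\<forall>\<^sub>F n in sequentially. g n = (if z > b then 1 else 0)"
      proof (cases "z > b")
        case True
        have "\<forall>\<^sub>F n in sequentially. 1 / real (Suc n) < z - b" using True by (intro small) simp
        then show ?thesis by eventually_elim (use True in \<open>auto simp: g_def max_def field_simps\<close>)
      next
        case False
        have "g n = 0" for n
        proof -
          have "0 < 1 / real (Suc n)" by simp
          then have "max 0 (z - (b + 1 / Suc n)) = 0" using False by linarith
          then show ?thesis using False by (simp add: g_def)
        qed
        then show ?thesis using False by simp
      qed
      moreover have "\<forall>\<^sub>F n in sequentially. f n = (if z \<ge> a then 1 else 0)"
      proof (cases "z \<ge> a")
        case True
        have "f n = 1" for n
        proof -
          have "0 < 1 / real (Suc n)" by simp
          then have "max 0 (z - (a - 1 / Suc n)) - max 0 (z - a) = 1 / Suc n" using True by linarith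
          then show ?thesis by (simp add: f_def)
        qed
        then show ?thesis using True by simp
      next
        case False
        have "\<forall>\<^sub>F n in sequentially. 1 / real (Suc n) < a - z" using False by (intro small) simp
        then show ?thesis
        proof eventually_elim
          case (elim n)
          then have "max 0 (z - (a - 1 / Suc n)) = 0" "max 0 (z - a) = 0" using False by linarith+
          then show ?case using False by (simp add: f_def)
        qed
      qed
      ultimately have "\<forall>\<^sub>F n in sequentially. real (Suc n) * K n z = indicator {a..b} z"
      proof eventually_elim
        case (elim n)
        have "real (Suc n) * K n z = f n - g n" by (simp only: K_def f_def g_def right_diff_distrib)
        then show ?case using elim \<open>a \<le> b\<close> by auto
      qed
      then show ?thesis by (rule tendsto_eventually)
    qed
    show "AE x in lborel. (\<lambda>n. std_normal_density x * (poly q x * (real (Suc n) * K n (poly h x))))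
        \<longlonglongrightarrow> std_normal_density x * (poly q x * indicator {a..b} (poly h x))"
      by (intro AE_I2 tendsto_mult_left lim)
    have K: "\<bar>real (Suc n) * K n z\<bar> \<le> 2" for n z
    proof -
      define e where "e = 1 / real (Suc n)"
      have "e > 0" by (simp add: e_def)
      then have "\<bar>K n z\<bar> \<le> 2 * e" unfolding K_def e_def[symmetric] by linarith
      then have "real (Suc n) * \<bar>K n z\<bar> \<le> real (Suc n) * (2 * e)" by (intro mult_left_mono) auto
      also have "\<dots> = 2" by (simp add: e_def del: of_nat_Suc)
      finally show ?thesis by (simp add: abs_mult)
    qed
    show "AE x in lborel. norm (std_normal_density x * (poly q x * (real (Suc n) * K n (poly h x))))
        \<le> std_normal_density x * \<bar>poly q x\<bar> * 2" for n
    proof (rule AE_I2)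
      fix x :: real
      have "std_normal_density x * \<bar>poly q x\<bar> * \<bar>real (Suc n) * K n (poly h x)\<bar> \<le> std_normal_density x * \<bar>poly q x\<bar> * 2"
        by (intro mult_left_mono K) auto
      then show "norm (std_normal_density x * (poly q x * (real (Suc n) * K n (poly h x))))
        \<le> std_normal_density x * \<bar>poly q x\<bar> * 2"
        by (simp only: real_norm_def abs_mult mult.assoc abs_of_nonneg[OF normal_density_nonneg])
    qed
    show "(\<lambda>x. std_normal_density x * (poly q x * (real (Suc n) * K n (poly h x)))) \<in> borel_measurable lborel" for n
      unfolding K_def by measurable
  qed measurable
  ultimately show ?thesis by (simp add: LIMSEQ_const_iff)
qed

section \<open>Polynomials with vanishing conditional expectation given \<open>h\<close>\<close>

lemma poly_lead_pos_at_top: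
  fixes h :: "real poly"
  assumes "lead_coeff h > 0" "degree h > 0"
  shows "filterlim (poly h) at_top at_top"
  unfolding filterlim_at_top
proof
  fix Z
  have "degree (h + [:-Z:]) = degree h"
    using assms(2) by (intro degree_add_eq_left) simp
  then have "lead_coeff (h + [:-Z:]) = lead_coeff h"
    using assms(2) by (simp add: coeff_eq_0)
  then obtain n where "\<And>x. x \<ge> n \<Longrightarrow> lead_coeff h \<le> poly (h + [:-Z:]) x"
    using poly_pinfty_gt_lc[of "h + [:-Z:]"] assms(1) by auto
  then have "Z \<le> poly h x" if "x \<ge> n" for x
    using assms(1) that by force
  then show "\<forall>\<^sub>F x in at_top. Z \<le> poly h x"
    by (rule eventually_at_top_linorderI)
qed

text \<open>\<open>g\<close> is the inverse of \<open>h\<close>, restricted to \<open>[R, \<infinity>)\<close>.\<close>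

definition top_branch :: "real poly \<Rightarrow> real \<Rightarrow> (real \<Rightarrow> real) \<Rightarrow> bool" where
  "top_branch h R g \<longleftrightarrow> (\<forall>y>poly h R. poly h (g y) = y \<and> poly (pderiv h) (g y) > 0 \<and>
        (g has_real_derivative inverse (poly (pderiv h) (g y))) (at y) \<and>
        (\<forall>x\<ge>R. (poly h x \<le> y \<longleftrightarrow> x \<le> g y) \<and> (y \<le> poly h x \<longleftrightarrow> g y \<le> x)) \<and> g y > R) \<and>
      filterlim g at_top at_top"

lemma top_branchD:
  assumes "top_branch h R g"
  shows "filterlim g at_top at_top"
    and "poly h R < y \<Longrightarrow> poly h (g y) = y"
    and "poly h R < y \<Longrightarrow> poly (pderiv h) (g y) > 0"
    and "poly h R < y \<Longrightarrow> (g has_real_derivative inverse (poly (pderiv h) (g y))) (at y)"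
    and "poly h R < y \<Longrightarrow> R \<le> x \<Longrightarrow> poly h x \<le> y \<longleftrightarrow> x \<le> g y"
    and "poly h R < y \<Longrightarrow> R \<le> x \<Longrightarrow> y \<le> poly h x \<longleftrightarrow> g y \<le> x"
    and "poly h R < y \<Longrightarrow> R < g y"
  using assms unfolding top_branch_def by blast+

lemma top_branch_mono:
  assumes "top_branch h R g" "poly h R < a" "a \<le> b"
  shows "g a \<le> g b"
  using top_branchD(5)[OF assms(1), of b "g a"] top_branchD(7)[OF assms(1,2)]
    top_branchD(2)[OF assms(1,2)] assms(2,3) by simp

text \<open>Beyond \<open>R0\<close> the derivative is positive, so \<open>h\<close> is increasing
  to infinity and the intermediate value theorem gives the inverse. Every \<open>R \<ge> R0\<close>
  is offered so that a common \<open>R\<close> can later serve both \<open>h\<close> and its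
  reflection.\<close>

lemma ex_top_branch:
  fixes h :: "real poly"
  assumes lc: "lead_coeff h > 0" and dh: "degree h > 0"
  obtains R0 where "\<And>R. R \<ge> R0 \<Longrightarrow> \<exists>g. top_branch h R g"
proof -
  have "lead_coeff (pderiv h) > 0"
    using lc dh by (simp add: degree_pderiv coeff_pderiv)
  then obtain R0 where R0: "\<And>x. x \<ge> R0 \<Longrightarrow> poly (pderiv h) x > 0"
    using poly_pinfty_gt_lc[of "pderiv h"] by (meson less_le_trans)
  have "\<exists>g. top_branch h R g" if "R \<ge> R0" for R
  proof -
    have mono: "poly h x < poly h x'" if "R \<le> x" "x < x'" for x x'
    proof (rule DERIV_pos_imp_increasing[OF \<open>x < x'\<close>])
      fix z assume "x \<le> z"
      then have "poly (pderiv h) z > 0" using R0[of z] \<open>R \<le> x\<close> \<open>R \<ge> R0\<close> by linarith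
      then show "\<exists>d. (poly h has_real_derivative d) (at z) \<and> 0 < d" using poly_DERIV by blast
    qed
    have le_iff: "poly h x \<le> poly h x' \<longleftrightarrow> x \<le> x'" if "R \<le> x" "R \<le> x'" for x x'
      using mono[of x x'] mono[of x' x] that by (cases x x' rule: linorder_cases) auto
    have "\<exists>x>R. poly h x = y" if "y > poly h R" for y
    proof -
      have "\<forall>\<^sub>F x in at_top. y \<le> poly h x \<and> x \<ge> R"
        using poly_lead_pos_at_top[OF lc dh] eventually_ge_at_top[of R]
        by (auto simp: filterlim_at_top eventually_conj_iff)
      then obtain b where b: "y \<le> poly h b" "b \<ge> R"
        using eventually_happens trivial_limit_at_top_linorder by blast
      then obtain x where "R \<le> x" "poly h x = y"
        using IVT[of "poly h" R y b] \<open>poly h R < y\<close> by auto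
      then show ?thesis using \<open>poly h R < y\<close> by (intro exI[of _ x]) (auto simp: less_le)
    qed
    then obtain g where g: "\<And>y. y > poly h R \<Longrightarrow> g y > R \<and> poly h (g y) = y" by metis
    have gh: "g (poly h x) = x" if "x > R" for x
      using g[of "poly h x"] mono[of R x] le_iff[of "g (poly h x)" x] le_iff[of x "g (poly h x)"] that
      by auto
    have cont: "isCont g y" if y: "y > poly h R" for y
    proof -
      obtain a where a: "R < a" "a < g y" using g[OF y] dense by blast
      have "isCont g (poly h (g y))"
        by (rule isCont_inverse_function2[of a "g y" "g y + 1"]) (use a gh in auto)
      then show ?thesis using g[OF y] by simp
    qed
    have pos: "poly (pderiv h) (g y) > 0" if "y > poly h R" for y
      using g[OF that] \<open>R \<ge> R0\<close> by (intro R0) linarith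
    have deriv: "(g has_real_derivative inverse (poly (pderiv h) (g y))) (at y)" if y: "y > poly h R" for y
      by (rule DERIV_inverse_function[of "poly h" _ _ _ "poly h R" "y + 1"])
        (use y g pos[OF y] cont[OF y] in \<open>auto intro: poly_DERIV\<close>)
    have iff: "(poly h x \<le> y \<longleftrightarrow> x \<le> g y) \<and> (y \<le> poly h x \<longleftrightarrow> g y \<le> x)" if "y > poly h R" "x \<ge> R" for x y
      using le_iff[of x "g y"] le_iff[of "g y" x] g[of y] that by auto
    have "filterlim g at_top at_top"
      unfolding filterlim_at_top
    proof
      fix Z
      show "\<forall>\<^sub>F y in at_top. Z \<le> g y"
        using eventually_gt_at_top[of "poly h (max R Z)"]
      proof eventually_elim
        case (elim y)
        moreover have "poly h R \<le> poly h (max R Z)" by (simp add: le_iff)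
        ultimately have "max R Z \<le> g y" using iff[of y "max R Z"] by auto
        then show ?case by simp
      qed
    qed
    then show ?thesis
      unfolding top_branch_def using g pos deriv iff by (intro exI[of _ g] conjI allI impI) simp_all
  qed
  then show ?thesis by (rule that)
qed

lemma isCont_std_normal_poly: "isCont (\<lambda>x. std_normal_density x * poly q x) x"
  by (rule DERIV_isCont, rule DERIV_mult[OF DERIV_std_normal_density poly_DERIV])

text \<open>Only the derivative of \<open>Q\<close> matters later. With it, integrals between branch
  points become differences that can be differentiated with respect to the level
  \<open>y\<close>.\<close>

lemma std_normal_antiderivative:
  obtains Q where "\<And>x. (Q has_real_derivative std_normal_density x * poly q x) (at x)"
proof -
  have "\<exists>F. \<forall>x::real. -\<infinity> < ereal x \<longrightarrow> ereal x < \<infinity> \<longrightarrow>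
      (F has_vector_derivative std_normal_density x * poly q x) (at x)"
    by (rule einterval_antiderivative) (simp_all add: isCont_std_normal_poly)
  then obtain Q where "\<And>x. (Q has_vector_derivative std_normal_density x * poly q x) (at x)" by auto
  then show ?thesis by (intro that[of Q]) (simp add: has_real_derivative_iff_has_vector_derivative)
qed

lemma gauss_indicator_Icc:
  assumes Q: "\<And>x. (Q has_real_derivative std_normal_density x * poly q x) (at x)" and "a \<le> b"
  shows "gauss (\<lambda>x. poly q x * indicator {a..b} x) = Q b - Q a"
proof -
  have "(LINT x|lborel. (std_normal_density x * poly q x) * indicator {a..b} x) = Q b - Q a"
    by (rule integral_FTC_Icc_real[OF \<open>a \<le> b\<close> Q isCont_std_normal_poly])
  then show ?thesis by (simp add: mult.assoc)
qed

text \<open>The right-hand side tends to 0 along \<open>s\<close>, whereas a nonconstant polynomial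
  is unbounded there and a constant is its own limit. It later excludes a nonzero \<open>c\<close>
  in the relation \<open>t = c - s\<close>.\<close>

lemma exp_decay_poly_eq_0:
  fixes p r :: "real poly"
  assumes k: "k > 0" and s: "filterlim s at_top F" "F \<noteq> bot"
    and eq: "\<forall>\<^sub>F y in F. poly r (s y) = poly p (s y) * (C * exp (- k * s y))"
  shows "r = 0"
proof -
  have "((\<lambda>x. x ^ i * exp (- k * x)) \<longlongrightarrow> 0) at_top" for i
  proof -
    have "filterlim (\<lambda>x. k * x) at_top at_top"
      using k by (simp add: filterlim_tendsto_pos_mult_at_top[OF tendsto_const] filterlim_ident)
    then have "((\<lambda>x. (k * x) ^ i / exp (k * x)) \<longlongrightarrow> 0) at_top"
      by (rule filterlim_compose[OF tendsto_power_div_exp_0])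
    from tendsto_mult_right_zero[OF this, of "1 / k ^ i"] show ?thesis
      using k by (simp add: power_mult_distrib exp_minus field_simps)
  qed
  then have "((\<lambda>x. \<Sum>i\<le>degree p. C * coeff p i * (x ^ i * exp (- k * x))) \<longlongrightarrow> 0) at_top"
    by (intro tendsto_null_sum tendsto_mult_right_zero)
  then have "((\<lambda>x. poly p x * (C * exp (- k * x))) \<longlongrightarrow> 0) at_top"
    by (simp add: poly_altdef sum_distrib_right sum_distrib_left mult_ac)
  from filterlim_compose[OF this s(1)] have lim: "((\<lambda>y. poly r (s y)) \<longlongrightarrow> 0) F"
    by (rule Lim_transform_eventually) (use eq in \<open>auto elim!: eventually_mono\<close>)
  have "degree r = 0"
  proof (rule ccontr)
    assume "degree r \<noteq> 0"
    then have "filterlim (poly r) at_infinity at_infinity" by (intro filterlim_poly_at_infinity) simp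
    then have "filterlim (\<lambda>y. poly r (s y)) at_infinity F"
      by (rule filterlim_compose) (use s(1) filterlim_at_top_imp_at_infinity in blast)
    then show False using lim s(2) not_tendsto_and_filterlim_at_infinity by blast
  qed
  then obtain d where "r = [:d:]" by (rule degree_eq_zeroE)
  then show ?thesis using lim s(2) by (simp add: tendsto_const_iff)
qed

text \<open>Over a large level the fibre is the single point \<open>g y\<close>, so the hypothesis
  makes \<open>Q (g y)\<close> constant in \<open>y\<close>. Its derivative is
  \<open>q (g y)\<close> times positive factors, hence \<open>q\<close> vanishes at arbitrarily
  large points.\<close>

lemma odd_degree_no_hidden_poly:
  fixes h q :: "real poly"
  assumes lc: "lead_coeff h > 0" and dh: "odd (degree h)"
    and ind: "\<And>a b. a \<le> b \<Longrightarrow> gauss (\<lambda>x. poly q x * indicator {a..b} (poly h x)) = 0"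
  shows "q = 0"
proof -
  have dpos: "degree h > 0" using dh by (rule odd_pos)
  obtain R0 where R0: "\<And>R. R \<ge> R0 \<Longrightarrow> \<exists>g. top_branch h R g"
    using ex_top_branch[OF lc dpos] by blast
  \<comment> \<open>Odd degree makes the leading coefficient of \<open>k\<close> positive, so
    \<open>h\<close> is nonpositive far to the left.\<close>
  define k where "k = - pcompose h [:0, -1:]"
  have "lead_coeff k > 0" "degree k > 0"
    using lc dh dpos lead_coeff_comp[of "[:0, -1:]" h] by (simp_all add: k_def degree_pcompose)
  then have "filterlim (poly k) at_top at_top" by (rule poly_lead_pos_at_top)
  then have "\<forall>\<^sub>F x in at_top. 0 \<le> poly k x" by (simp add: filterlim_at_top)
  then obtain R1 where R1: "\<And>x. x \<ge> R1 \<Longrightarrow> poly h (- x) \<le> 0"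
    by (auto simp: k_def poly_pcompose eventually_at_top_linorder)
  define R where "R = Max {R0, R1, 0}"
  have R: "R \<ge> R0" "R \<ge> R1" "R \<ge> 0" by (auto simp: R_def)
  obtain g where br: "top_branch h R g" using R0[OF R(1)] by blast
  note g = top_branchD[OF br]
  obtain B where B: "\<And>x. - R \<le> x \<Longrightarrow> x \<le> R \<Longrightarrow> poly h x \<le> B"
    using isCont_bounded[of "- R" R "poly h"] R(3) by auto
  \<comment> \<open>Above \<open>y0\<close> the fibre of \<open>h\<close> misses
    \<open>[-R, R]\<close> and the left half line, leaving just the point on the branch
    \<open>g\<close>.\<close>
  define y0 where "y0 = Max {B, 0, poly h R}"
  have y0: "y0 \<ge> B" "y0 \<ge> 0" "y0 \<ge> poly h R" by (auto simp: y0_def)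
  obtain Q where Q: "\<And>x. (Q has_real_derivative std_normal_density x * poly q x) (at x)"
    using std_normal_antiderivative[of q] by blast
  have eqQ: "Q (g b) = Q (g a)" if "y0 < a" "a \<le> b" for a b
  proof -
    have ga: "a > poly h R" "b > poly h R" using that y0 by linarith+
    have "indicator {a..b} (poly h x) = (indicator {g a..g b} x :: real)" for x
    proof (cases "x \<ge> R")
      case True
      then show ?thesis using g(5)[OF ga(2) True] g(6)[OF ga(1) True] by (simp add: indicator_def)
    next
      case False
      then have "poly h x \<le> y0" using B[of x] R1[of "- x"] R y0 by (cases "- R \<le> x") auto
      moreover have "g a > R" using g(7)[OF ga(1)] .
      ultimately show ?thesis using False that by (simp add: indicator_def)
    qed
    moreover have "g a \<le> g b" by (rule top_branch_mono[OF br ga(1) \<open>a \<le> b\<close>])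
    ultimately show ?thesis
      using gauss_indicator_Icc[OF Q, of "g a" "g b"] ind[OF \<open>a \<le> b\<close>] by simp
  qed
  have "poly q (g y) = 0" if y: "y > y0" for y
  proof -
    have gy: "y > poly h R" using y y0 by linarith
    have "((\<lambda>y. Q (g y)) has_real_derivative
        std_normal_density (g y) * poly q (g y) * inverse (poly (pderiv h) (g y))) (at y)"
      by (rule DERIV_chain2[OF Q g(4)[OF gy]])
    moreover have "((\<lambda>y. Q (g y)) has_real_derivative 0) (at y)"
    proof (rule has_field_derivative_transform_within_open[of "\<lambda>_. Q (g y)" _ _ "{y0<..}"])
      show "Q (g y) = Q (g z)" if "z \<in> {y0<..}" for z
        using eqQ[of y z] eqQ[of z y] that y by (cases "y \<le> z") auto
    qed (use y in auto)
    ultimately have "std_normal_density (g y) * poly q (g y) * inverse (poly (pderiv h) (g y)) = 0"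
      by (rule DERIV_unique)
    then show ?thesis
      using g(3)[OF gy] normal_density_pos[of 1 0 "g y"] by simp
  qed
  then have "\<forall>\<^sub>F y in at_top. poly q (g y) = poly 0 (g y)"
    by (intro eventually_mono[OF eventually_gt_at_top[of y0]]) simp
  then show "q = 0"
    by (rule poly_eq_if_eventually_eq[OF _ filterlim_at_top_imp_at_infinity[OF g(1)] trivial_limit_at_top_linorder])
qed

lemma integrable_std_normal_indicator:
  assumes [measurable]: "S \<in> sets borel" "f \<in> borel_measurable borel"
  shows "integrable lborel (\<lambda>x. std_normal_density x * (poly q x * indicator S (f x)))"
proof (rule integrable_std_normal_poly_bounded)
  show "poly_bounded (\<lambda>x. poly q x * indicator S (f x))"
    by (rule poly_bounded_mono[OF poly_bounded_poly[of q]]) (auto simp: indicator_def)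
qed measurable

lemma gauss_uminus: "gauss (\<lambda>x. F (- x)) = gauss F"
  using lborel_integral_real_affine[of "-1" "\<lambda>x. std_normal_density x * F x" 0]
  by (simp add: std_normal_density_def)

lemma even_degree_hidden_poly:
  fixes h q :: "real poly"
  assumes lc: "lead_coeff h > 0" and dh: "even (degree h)" "degree h > 0" and q: "q \<noteq> 0"
    and ind: "\<And>a b. a \<le> b \<Longrightarrow> gauss (\<lambda>x. poly q x * indicator {a..b} (poly h x)) = 0"
  shows "pcompose h [:0, -1:] = h \<and> pcompose q [:0, -1:] = - q"
proof -
  \<comment> \<open>The left branch of \<open>h\<close> is \<open>- f y\<close> for the right branch
    \<open>f\<close> of the reflected polynomial \<open>k\<close>, so one construction covers both
    ends.\<close>
  define k where "k = pcompose h [:0, -1:]"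
  define r where "r = pcompose q [:0, -1:]"
  have poly_k: "poly k x = poly h (- x)" and poly_k': "poly (pderiv k) x = - poly (pderiv h) (- x)"
    and poly_k'': "poly (pderiv (pderiv k)) x = poly (pderiv (pderiv h)) (- x)"
    and poly_r: "poly r x = poly q (- x)" and poly_r': "poly (pderiv r) x = - poly (pderiv q) (- x)" for x
    by (simp_all add: k_def r_def poly_pcompose pderiv_pcompose pderiv_mult pderiv_minus pderiv_pCons)
  have "lead_coeff k > 0" "degree k > 0"
    using lc dh lead_coeff_comp[of "[:0, -1:]" h] by (simp_all add: k_def degree_pcompose)
  then obtain R1 R2 where R1: "\<And>R. R \<ge> R1 \<Longrightarrow> \<exists>g. top_branch h R g"
    and R2: "\<And>R. R \<ge> R2 \<Longrightarrow> \<exists>g. top_branch k R g"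
    using ex_top_branch lc dh(2) by metis
  define R where "R = Max {R1, R2, 1}"
  have R: "R \<ge> R1" "R \<ge> R2" "R \<ge> 1" by (auto simp: R_def)
  obtain g f where brg: "top_branch h R g" and brf: "top_branch k R f"
    using R1[OF R(1)] R2[OF R(2)] by blast
  note g = top_branchD[OF brg] and f = top_branchD[OF brf]
  obtain B where B: "\<And>x. - R \<le> x \<Longrightarrow> x \<le> R \<Longrightarrow> poly h x \<le> B"
    using isCont_bounded[of "- R" R "poly h"] R(3) by auto
  have hB: "poly h R < y" "poly k R < y" if "y > B" for y
    using B[of R] B[of "- R"] R(3) that by (auto simp: poly_k)
  obtain Q P where Q: "\<And>x. (Q has_real_derivative std_normal_density x * poly q x) (at x)"
      and P: "\<And>x. (P has_real_derivative std_normal_density x * poly r x) (at x)"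
    using std_normal_antiderivative[of q] std_normal_antiderivative[of r] by metis
  have eqQ: "Q (g b) + P (f b) = Q (g a) + P (f a)" if "B < a" "a \<le> b" for a b
  proof -
    have "B < b" using that by linarith
    note a = hB[OF \<open>B < a\<close>] and b = hB[OF \<open>B < b\<close>]
    \<comment> \<open>Above \<open>B\<close> the fibre avoids \<open>[-R, R]\<close>. As
      \<open>R \<ge> 1\<close>, the right and left pieces are disjoint, so their indicators
      add.\<close>
    have ind_eq: "indicator {a..b} (poly h x)
        = (indicator {g a..g b} x + indicator {f a..f b} (- x) :: real)" for x
    proof -
      have gf: "g a > R" "f a > R" using g(7)[OF a(1)] f(7)[OF a(2)] by auto
      consider "x \<ge> R" | "- x \<ge> R" | "- R < x" "x < R" by linarith
      then show ?thesis
      proof cases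
        case 1
        then show ?thesis using g(5)[OF b(1) 1] g(6)[OF a(1) 1] gf R(3) by (simp add: indicator_def)
      next
        case 2
        then show ?thesis using f(5)[OF b(2) 2] f(6)[OF a(2) 2] gf R(3) by (simp add: indicator_def poly_k)
      next
        case 3
        then have "poly h x < a" using B[of x] \<open>B < a\<close> by simp
        then show ?thesis using 3 gf by (simp add: indicator_def)
      qed
    qed
    have "0 = gauss (\<lambda>x. poly q x * indicator {a..b} (poly h x))"
      using ind[OF \<open>a \<le> b\<close>] by simp
    also have "\<dots> = (LINT x|lborel. std_normal_density x * (poly q x * indicator {g a..g b} x)
        + std_normal_density x * (poly q x * indicator {f a..f b} (- x)))"
      by (simp add: ind_eq distrib_left)
    also have "\<dots> = gauss (\<lambda>x. poly q x * indicator {g a..g b} x)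
        + gauss (\<lambda>x. poly q x * indicator {f a..f b} (- x))"
      by (intro Bochner_Integration.integral_add integrable_std_normal_indicator) auto
    also have "gauss (\<lambda>x. poly q x * indicator {f a..f b} (- x))
        = gauss (\<lambda>x. poly r x * indicator {f a..f b} x)"
      using gauss_uminus[of "\<lambda>x. poly r x * indicator {f a..f b} x"] by (simp add: poly_r)
    finally show ?thesis
      using gauss_indicator_Icc[OF Q top_branch_mono[OF brg a(1) \<open>a \<le> b\<close>]]
        gauss_indicator_Icc[OF P top_branch_mono[OF brf a(2) \<open>a \<le> b\<close>]] by simp
  qed
  define \<phi> where "\<phi> = std_normal_density"
  have \<phi>: "\<phi> x > 0" "(\<phi> has_real_derivative - x * \<phi> x) (at x)" for x
    using DERIV_std_normal_density[of x] by (simp_all add: \<phi>_def normal_density_pos)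
  \<comment> \<open>Differentiate \<open>Q (g y) + P (f y)\<close>, which is constant by
    \<open>eqQ\<close>. The plus sign does express agreement of \<open>q \<phi> / h'\<close> at
    \<open>g y\<close> and \<open>- f y\<close>, since the derivative of \<open>k\<close> at
    \<open>f y\<close> is minus that of \<open>h\<close> at \<open>- f y\<close>.\<close>
  have dens: "\<phi> (g y) * poly q (g y) / poly (pderiv h) (g y) + \<phi> (f y) * poly r (f y) / poly (pderiv k) (f y) = 0"
    if y: "y > B" for y
  proof -
    have "((\<lambda>y. Q (g y) + P (f y)) has_real_derivative
        \<phi> (g y) * poly q (g y) * inverse (poly (pderiv h) (g y))
        + \<phi> (f y) * poly r (f y) * inverse (poly (pderiv k) (f y))) (at y)"
      unfolding \<phi>_def
      by (intro DERIV_add DERIV_chain2[OF Q g(4)] DERIV_chain2[OF P f(4)] hB y)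
    moreover have "((\<lambda>y. Q (g y) + P (f y)) has_real_derivative 0) (at y)"
    proof (rule has_field_derivative_transform_within_open[of "\<lambda>_. Q (g y) + P (f y)" _ _ "{B<..}"])
      show "Q (g y) + P (f y) = Q (g z) + P (f z)" if "z \<in> {B<..}" for z
        using eqQ[of y z] eqQ[of z y] that y by (cases "y \<le> z") auto
    qed (use y in auto)
    ultimately show ?thesis by (auto dest: DERIV_unique simp: divide_inverse)
  qed
  \<comment> \<open>Along a branch, \<open>N / D\<close> is the logarithmic derivative in
    \<open>y\<close> of \<open>q \<phi> / h'\<close>. The Gaussian factor cancels, so it is
    rational. \<open>N2\<close> is the same numerator for the reflected pair \<open>r\<close>,
    \<open>k\<close>.\<close>
  define N where "N = pderiv q * pderiv h - [:0, 1:] * q * pderiv h - q * pderiv (pderiv h)"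
  define D where "D = q * pderiv h ^ 2"
  define N2 where "N2 = pderiv r * pderiv k - [:0, 1:] * r * pderiv k - r * pderiv (pderiv k)"
  have N2: "poly N2 x = poly N (- x)" for x
    by (simp add: N_def N2_def poly_k' poly_k'' poly_r poly_r')
  have quot: "((\<lambda>x. \<phi> x * poly p x / poly (pderiv l) x) has_real_derivative \<phi> x *
      poly (pderiv p * pderiv l - [:0, 1:] * p * pderiv l - p * pderiv (pderiv l)) x / poly (pderiv l) x ^ 2) (at x)"
    if "poly (pderiv l) x \<noteq> 0" for p l x
    by (rule DERIV_cong, rule DERIV_divide[OF DERIV_mult[OF \<phi>(2) poly_DERIV] poly_DERIV that])
      (simp add: algebra_simps power2_eq_square)
  \<comment> \<open>This is the derivative of \<open>dens\<close> divided by \<open>dens\<close>.\<close>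
  have ND: "poly N (g y) * poly D (- f y) = poly N (- f y) * poly D (g y)" if y: "y > B" for y
  proof -
    define G where "G = poly (pderiv h) (g y)"
    define F where "F = poly (pderiv k) (f y)"
    have pos: "G > 0" "F > 0" using g(3)[OF hB(1)[OF y]] f(3)[OF hB(2)[OF y]] by (simp_all add: G_def F_def)
    have "((\<lambda>y. \<phi> (g y) * poly q (g y) / poly (pderiv h) (g y) + \<phi> (f y) * poly r (f y) / poly (pderiv k) (f y))
        has_real_derivative \<phi> (g y) * poly N (g y) / G\<^sup>2 * inverse G + \<phi> (f y) * poly N2 (f y) / F\<^sup>2 * inverse F) (at y)"
      unfolding N_def N2_def G_def F_def
      using pos unfolding G_def F_def
      by (intro DERIV_add DERIV_chain2[OF quot g(4)] DERIV_chain2[OF quot f(4)] hB y) auto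
    moreover have "((\<lambda>y. \<phi> (g y) * poly q (g y) / poly (pderiv h) (g y) + \<phi> (f y) * poly r (f y) / poly (pderiv k) (f y))
        has_real_derivative 0) (at y)"
      by (rule has_field_derivative_transform_within_open[of "\<lambda>_. 0" _ _ "{B<..}"]) (use y dens in auto)
    ultimately have "\<phi> (g y) * poly N (g y) / G\<^sup>2 * inverse G + \<phi> (f y) * poly N2 (f y) / F\<^sup>2 * inverse F = 0"
      by (rule DERIV_unique)
    moreover define \<alpha> \<beta> where "\<alpha> = \<phi> (g y) / G" and "\<beta> = \<phi> (f y) / F"
    ultimately have e1: "\<alpha> * (poly N (g y) / G\<^sup>2) + \<beta> * (poly N2 (f y) / F\<^sup>2) = 0"
      by (simp add: field_simps)
    have e2: "\<alpha> * poly q (g y) + \<beta> * poly r (f y) = 0"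
      using dens[OF y] by (simp add: \<alpha>_def \<beta>_def G_def F_def)
    \<comment> \<open>\<open>e1\<close> and \<open>e2\<close> form a homogeneous linear system for
      \<open>\<alpha>\<close> and \<open>\<beta>\<close>. Its determinant must vanish, which removes
      both Gaussian factors.\<close>
    have "\<beta> \<noteq> 0" using \<phi>(1)[of "f y"] pos by (simp add: \<beta>_def)
    have "\<beta> * (poly N (g y) / G\<^sup>2 * poly r (f y) - poly N2 (f y) / F\<^sup>2 * poly q (g y)) = 0"
      using e1 e2 by algebra
    then have "poly N (g y) / G\<^sup>2 * poly r (f y) = poly N2 (f y) / F\<^sup>2 * poly q (g y)"
      using \<open>\<beta> \<noteq> 0\<close> by simp
    then have "poly N (g y) * (poly r (f y) * F\<^sup>2) = poly N2 (f y) * (poly q (g y) * G\<^sup>2)"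
      using pos by (simp add: field_simps)
    then show ?thesis by (simp add: D_def G_def F_def poly_k' poly_r N2)
  qed
  define n where "n = degree h"
  have n: "n \<ge> 2" using dh by (auto simp: n_def elim!: evenE)
  have dh': "degree (pderiv h) = n - 1" by (simp add: degree_pderiv n_def)
  then have h'0: "pderiv h \<noteq> 0" using n by auto
  have main: "degree (q * pderiv h) = degree q + n - 1"
    using q h'0 n by (simp add: degree_mult_eq dh')
  \<comment> \<open>The term - x q h' has degree \<open>degree q + n\<close>, and the other two
    terms of \<open>N\<close> have degree at most \<open>degree q + n - 2\<close>. Together with
    \<open>dD\<close> this yields the degree condition of
    \<open>rational_conjugate_is_reflection\<close>.\<close>
  have dN: "degree N = degree q + n" "N \<noteq> 0"
  proof -
    define low where "low = pderiv q * pderiv h - q * pderiv (pderiv h)"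
    have "degree low \<le> degree q + n - 2"
      unfolding low_def
    proof (rule degree_diff_le)
      show "degree (pderiv q * pderiv h) \<le> degree q + n - 2"
      proof (cases "degree q = 0")
        case True
        then have "pderiv q = 0" by (simp add: pderiv_eq_0_iff)
        then show ?thesis by simp
      next
        case False
        then show ?thesis
          using degree_mult_le[of "pderiv q" "pderiv h"] n dh' by (simp add: degree_pderiv)
      qed
      show "degree (q * pderiv (pderiv h)) \<le> degree q + n - 2"
        using degree_mult_le[of q "pderiv (pderiv h)"] n dh' by (simp add: degree_pderiv)
    qed
    moreover define lead where "lead = - pCons 0 (q * pderiv h)"
    moreover have "degree lead = degree q + n"
      using q h'0 n main by (simp add: lead_def)
    moreover have "N = lead + low" by (simp add: N_def low_def lead_def)
    ultimately show "degree N = degree q + n"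
      using n degree_add_eq_left[of low lead] by simp
    then show "N \<noteq> 0" using n by auto
  qed
  have dD: "degree D = degree q + 2 * (n - 1)" "D \<noteq> 0"
    using q h'0 by (simp_all add: D_def degree_mult_eq degree_power_eq dh')
  have "\<exists>c. \<forall>\<^sub>F y in at_top. g y + - f y = c"
  proof (rule rational_conjugate_is_reflection[of at_top g "\<lambda>y. - f y" h "n div 2" N D])
    show "filterlim (\<lambda>y. - f y) at_bot at_top" using f(1) by (simp add: filterlim_uminus_at_bot)
    show "\<forall>\<^sub>F y in at_top. poly h (g y) = poly h (- f y)"
      using eventually_gt_at_top[of B] by eventually_elim (metis g(2) f(2) hB poly_k)
    show "\<forall>\<^sub>F y in at_top. poly N (g y) * poly D (- f y) = poly N (- f y) * poly D (g y)"
      using eventually_gt_at_top[of B] by eventually_elim (rule ND)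
  qed (use g(1) dh n dN dD in \<open>auto simp: n_def\<close>)
  then obtain c where "\<forall>\<^sub>F y in at_top. g y + - f y = c" by blast
  then have c: "\<forall>\<^sub>F y in at_top. f y = g y - c" by eventually_elim simp
  have g_inf: "filterlim g at_infinity at_top" by (rule filterlim_at_top_imp_at_infinity[OF g(1)])
  note poly_eqI' = poly_eq_if_eventually_eq[OF _ g_inf trivial_limit_at_top_linorder]
  have hc: "pcompose h [:c, -1:] = h"
  proof (rule poly_eqI')
    show "\<forall>\<^sub>F y in at_top. poly (pcompose h [:c, -1:]) (g y) = poly h (g y)"
      using c eventually_gt_at_top[of B]
    proof eventually_elim
      case (elim y)
      have "poly h (c - g y) = y" using f(2)[OF hB(2)[OF elim(2)]] elim(1) by (simp add: poly_k)
      then show ?case using g(2)[OF hB(1)[OF elim(2)]] by (simp add: poly_pcompose)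
    qed
  qed
  have h'c: "poly (pderiv h) (c - x) = - poly (pderiv h) x" for x
  proof -
    have "poly (pderiv (pcompose h [:c, -1:])) x = - poly (pderiv h) (c - x)"
      by (simp add: pderiv_pcompose poly_pcompose pderiv_pCons)
    then show ?thesis by (simp add: hc)
  qed
  \<comment> \<open>With the two points being x and c - x, the values of \<open>h'\<close> are
    opposite by \<open>h'c\<close> and drop out of \<open>dens\<close>.\<close>
  have rel: "\<forall>\<^sub>F y in at_top. \<phi> (g y) * poly q (g y) + \<phi> (c - g y) * poly q (c - g y) = 0"
    using c eventually_gt_at_top[of B]
  proof eventually_elim
    case (elim y)
    have "\<phi> (f y) = \<phi> (c - g y)"
      using elim(1) by (simp add: \<phi>_def std_normal_density_def power2_commute)
    moreover have "poly (pderiv k) (f y) = poly (pderiv h) (g y)"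
      using elim(1) h'c[of "g y"] by (simp add: poly_k')
    moreover have "poly r (f y) = poly q (c - g y)" using elim(1) by (simp add: poly_r)
    ultimately show ?case
      using dens[OF elim(2)] g(3)[OF hB(1)[OF elim(2)]] by (simp flip: add_divide_distrib)
  qed
  have ratio: "\<phi> x = \<phi> (c - x) * (exp (c\<^sup>2 / 2) * exp (- c * x))" for x
    by (simp add: \<phi>_def std_normal_density_def power2_eq_square algebra_simps add_divide_distrib diff_divide_distrib
        flip: exp_add)
  \<comment> \<open>By \<open>ratio\<close>, solving \<open>rel\<close> for q(c - x) when c > 0, and
    for q(x) when c < 0, equates a nonzero polynomial with a polynomial times a decaying
    exponential.\<close>
  have c0: "c = 0"
  proof (rule ccontr)
    assume "c \<noteq> 0"
    then consider "c > 0" | "- c > 0" by linarith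
    then show False
    proof cases
      case 1
      have "\<forall>\<^sub>F y in at_top. poly (pcompose q [:c, -1:]) (g y)
          = poly (- q) (g y) * (exp (c\<^sup>2 / 2) * exp (- c * g y))"
        using rel
      proof eventually_elim
        case (elim y)
        then have "\<phi> (c - g y) * (poly q (g y) * (exp (c\<^sup>2 / 2) * exp (- c * g y)) + poly q (c - g y)) = 0"
          using ratio[of "g y"] by (simp add: algebra_simps)
        then show ?case using \<phi>(1)[of "c - g y"] by (simp add: poly_pcompose)
      qed
      then have "pcompose q [:c, -1:] = 0"
        by (rule exp_decay_poly_eq_0[OF 1 g(1) trivial_limit_at_top_linorder])
      then show False using q pcompose_eq_0[of q "[:c, -1:]"] by simp
    next
      case 2
      have "\<forall>\<^sub>F y in at_top. poly q (g y)
          = poly (- pcompose q [:c, -1:]) (g y) * (exp (- (c\<^sup>2 / 2)) * exp (- (- c) * g y))"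
        using rel
      proof eventually_elim
        case (elim y)
        define E where "E = exp (c\<^sup>2 / 2) * exp (- c * g y)"
        have "E \<noteq> 0" by (simp add: E_def)
        from elim have "\<phi> (c - g y) * (poly q (g y) * E + poly q (c - g y)) = 0"
          using ratio[of "g y"] by (simp add: algebra_simps E_def)
        then have "poly q (g y) * E = - poly q (c - g y)" using \<phi>(1)[of "c - g y"] by simp
        then have "poly q (g y) = - poly q (c - g y) * inverse E"
          using \<open>E \<noteq> 0\<close> by (simp add: field_simps)
        moreover have "inverse E = exp (- (c\<^sup>2 / 2)) * exp (- (- c) * g y)"
          by (simp add: E_def exp_minus)
        ultimately show ?case by (simp add: poly_pcompose)
      qed
      then have "q = 0"
        by (rule exp_decay_poly_eq_0[OF 2 g(1) trivial_limit_at_top_linorder])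
      then show False using q by simp
    qed
  qed
  have "pcompose q [:c, -1:] = - q"
  proof (rule poly_eqI')
    show "\<forall>\<^sub>F y in at_top. poly (pcompose q [:c, -1:]) (g y) = poly (- q) (g y)"
      using rel
    proof eventually_elim
      case (elim y)
      have "\<phi> (- g y) = \<phi> (g y)" by (simp add: \<phi>_def std_normal_density_def)
      then have "\<phi> (g y) * (poly q (g y) + poly q (- g y)) = 0"
        using elim by (simp add: c0 algebra_simps)
      then show ?case using \<phi>(1)[of "g y"] by (simp add: poly_pcompose c0)
    qed
  qed
  then show ?thesis using hc by (simp add: c0)
qed

section \<open>Polynomials in one variable as univariate polynomials\<close>

text \<open>The leading term of x u lies above the degree of u', so nothing can cancel it.\<close>

lemma hermite_preimage_unique:
  fixes u :: "real poly"
  assumes "[:c:] + [:0, 1:] * u - pderiv u = 0"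
  shows "u = 0"
proof (rule ccontr)
  assume "u \<noteq> 0"
  then have "coeff (pCons c u) (Suc (degree u)) \<noteq> 0" by simp
  moreover have "coeff (pderiv u) (Suc (degree u)) = 0"
    by (simp add: coeff_pderiv coeff_eq_0)
  moreover have "pCons c u = pderiv u" using assms by simp
  ultimately show False by metis
qed

text \<open>If \<open>q t\<close> is even, the even part of \<open>u t\<close> solves x v - v' = 0
  and is therefore 0. So \<open>u t\<close> is odd, and its product with the odd polynomial h' is
  even again.\<close>

lemma stein_chain_even:
  fixes h :: "real poly" and r :: "real poly"
  defines "r \<equiv> [:0, -1:]"
  assumes h: "pcompose h r = h"
    and q0: "q 0 = pcompose (p 0) h"
    and q: "\<And>t. t < T \<Longrightarrow> q t = [:c t:] + [:0, 1:] * u t - pderiv (u t)"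
    and qS: "\<And>t. t < T \<Longrightarrow> q (Suc t) = pderiv h * u t + pcompose (p (Suc t)) h"
    and "t \<le> T"
  shows "pcompose (q t) r = q t"
  using \<open>t \<le> T\<close>
proof (induction t)
  case 0
  then show ?case by (simp add: q0 h flip: pcompose_assoc)
next
  case (Suc t)
  have h': "pcompose (pderiv h) r = - pderiv h"
  proof -
    have "pderiv (pcompose h r) = - pcompose (pderiv h) r"
      by (simp add: pderiv_pcompose r_def pderiv_pCons)
    then show ?thesis by (simp add: h)
  qed
  define v where "v = u t + pcompose (u t) r"
  have "pcompose (q t) r = [:c t:] - [:0, 1:] * pcompose (u t) r + pderiv (pcompose (u t) r)"
    using Suc.prems
    by (simp add: q r_def pcompose_add pcompose_diff pcompose_mult pcompose_pCons pderiv_pcompose pderiv_pCons)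
  moreover have "q t = [:c t:] + [:0, 1:] * u t - pderiv (u t)" using Suc.prems by (simp add: q)
  moreover define X where "X = [:0, 1 :: real:]"
  ultimately have "q t - pcompose (q t) r = X * v - pderiv v"
    by (simp add: v_def pderiv_add distrib_left)
  then have "[:0:] + [:0, 1:] * v - pderiv v = 0"
    using Suc by (simp add: X_def)
  then have "v = 0" by (rule hermite_preimage_unique)
  then have "pcompose (u t) r = - u t" by (simp add: v_def add_eq_0_iff)
  then show ?case
    using Suc.prems by (simp add: qS pcompose_add pcompose_mult h' h flip: pcompose_assoc)
qed

theorem stein_chain_terminal_eq_0:
  fixes h :: "real poly"
  assumes dh: "degree h > 0"
    and q0: "q 0 = pcompose (p 0) h"
    and q: "\<And>t. t < T \<Longrightarrow> q t = [:c t:] + [:0, 1:] * u t - pderiv (u t)"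
    and qS: "\<And>t. t < T \<Longrightarrow> q (Suc t) = pderiv h * u t + pcompose (p (Suc t)) h"
    and ind: "\<And>a b. a \<le> b \<Longrightarrow> gauss (\<lambda>x. poly (q T) x * indicator {a..b} (poly h x)) = 0"
  shows "q T = 0"
proof (rule ccontr)
  assume nz: "q T \<noteq> 0"
  \<comment> \<open>Only the level sets are normalised to a positive leading coefficient; a sign
    change merely reflects the intervals. The chain is kept for \<open>h\<close>, which inherits
    evenness from \<open>k\<close>.\<close>
  define k where "k = (if lead_coeff h > 0 then h else - h)"
  have "h \<noteq> 0" using dh by auto
  then have "lead_coeff h < 0 \<or> lead_coeff h > 0"
    unfolding linorder_neq_iff[symmetric] leading_coeff_0_iff .
  then have k: "lead_coeff k > 0" "degree k = degree h" "k = h \<or> k = - h"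
    by (auto simp: k_def)
  have ind_k: "gauss (\<lambda>x. poly (q T) x * indicator {a..b} (poly k x)) = 0" if "a \<le> b" for a b
  proof (cases "k = h")
    case False
    then have "indicator {a..b} (poly k x) = (indicator {-b..-a} (poly h x) :: real)" for x
      using k(3) by (auto simp: indicator_def)
    then show ?thesis using ind[of "-b" "-a"] that by simp
  qed (use ind that in simp)
  show False
  proof (cases "even (degree k)")
    case False
    then show ?thesis using odd_degree_no_hidden_poly[OF k(1) False ind_k] nz by simp
  next
    case True
    then have "pcompose k [:0, -1:] = k" "pcompose (q T) [:0, -1:] = - q T"
      using even_degree_hidden_poly[OF k(1) True _ nz ind_k] k(2) dh by auto
    moreover from this(1) k(3) have "pcompose h [:0, -1:] = h" by (auto simp: pcompose_uminus)
    then have "pcompose (q T) [:0, -1:] = q T"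
      by (rule stein_chain_even[OF _ q0 q qS order_refl])
    ultimately have "q T = - q T" by simp
    then show ?thesis using nz by (simp add: equal_neg_zero)
  qed
qed

section \<open>Evaluation of multivariate polynomials\<close>

definition mono_eval :: "('n::finite \<Rightarrow>\<^sub>0 nat) \<Rightarrow> ('n \<Rightarrow> real) \<Rightarrow> real" where
  "mono_eval \<alpha> x = (\<Prod>k\<in>UNIV. x k ^ Poly_Mapping.lookup \<alpha> k)"

lemma mono_eval_add: "mono_eval (\<alpha> + \<beta>) x = mono_eval \<alpha> x * mono_eval \<beta> x"
  by (simp add: mono_eval_def lookup_add power_add prod.distrib)

lemma meval_superset:
  assumes "finite A" "Poly_Mapping.keys p \<subseteq> A"
  shows "meval p x = (\<Sum>\<alpha>\<in>A. Poly_Mapping.lookup p \<alpha> * mono_eval \<alpha> x)"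
  unfolding meval_def mono_eval_def using assms
  by (intro sum.mono_neutral_left) (auto simp: in_keys_iff)

lemma meval_add: "meval (p + q) x = meval p x + meval q x"
proof -
  let ?A = "Poly_Mapping.keys p \<union> Poly_Mapping.keys q"
  have "Poly_Mapping.keys (p + q) \<subseteq> ?A" by (rule Poly_Mapping.keys_add)
  then show ?thesis
    using meval_superset[of ?A "p + q" x] meval_superset[of ?A p x] meval_superset[of ?A q x]
    by (simp add: lookup_add distrib_right sum.distrib)
qed

lemma meval_0 [simp]: "meval 0 x = 0" by (simp add: meval_def)

lemma meval_sum: "meval (\<Sum>i\<in>A. f i) x = (\<Sum>i\<in>A. meval (f i) x)"
  by (induction A rule: infinite_finite_induct) (auto simp: meval_add)

lemma meval_single: "meval (Poly_Mapping.single \<alpha> c) x = c * mono_eval \<alpha> x"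
  using meval_superset[of "{\<alpha>}" "Poly_Mapping.single \<alpha> c" x] by (simp add: lookup_single)

lemma meval_mult: "meval (p * q) x = meval p x * meval q x"
proof -
  have expand: "r = (\<Sum>\<alpha>\<in>Poly_Mapping.keys r. Poly_Mapping.single \<alpha> (Poly_Mapping.lookup r \<alpha>))" for r :: "'a mpoly"
    using mpoly_expand[of r] by (simp add: mext_def mconst_def mult_single)
  have "meval (p * q) x = (\<Sum>\<alpha>\<in>Poly_Mapping.keys p. \<Sum>\<beta>\<in>Poly_Mapping.keys q.
      (Poly_Mapping.lookup p \<alpha> * mono_eval \<alpha> x) * (Poly_Mapping.lookup q \<beta> * mono_eval \<beta> x))"
    by (subst expand[of p], subst expand[of q])
      (simp add: sum_product mult_single meval_sum meval_single mono_eval_add mult_ac)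
  then show ?thesis
    by (simp add: meval_superset[of "Poly_Mapping.keys p" p] meval_superset[of "Poly_Mapping.keys q" q] sum_product)
qed

lemma meval_mconst [simp]: "meval (mconst c) x = c"
  by (simp add: mconst_def meval_single mono_eval_def)

lemma meval_1 [simp]: "meval 1 x = 1"
  using meval_mconst[of 1 x] by (simp del: meval_mconst)

lemma meval_mvar: "meval (mvar k) x = x k"
proof -
  have "mono_eval (Poly_Mapping.single k 1) x = (\<Prod>i\<in>UNIV. if i = k then x i else 1)"
    unfolding mono_eval_def by (intro prod.cong) (auto simp: lookup_single when_def)
  then show ?thesis by (simp add: mvar_def meval_single)
qed

lemma meval_prod: "meval (\<Prod>i\<in>A. f i) x = (\<Prod>i\<in>A. meval (f i) x)"
  by (induction A rule: infinite_finite_induct) (auto simp: meval_mult)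

lemma meval_msubst: "meval (msubst p q) x = poly p (meval q x)"
proof -
  have "meval (poly (map_poly mconst p) q) x = poly p (meval q x)"
    by (induction p) (auto simp: meval_add meval_mult map_poly_pCons)
  then show ?thesis by (simp add: msubst_def)
qed

lemma meval_mhermite: "meval (mhermite \<alpha>) x = (\<Prod>k\<in>UNIV. poly (hermite (Poly_Mapping.lookup \<alpha> k)) (x k))"
  by (simp add: mhermite_def meval_prod meval_msubst meval_mvar)

lemma pderiv_sum: "pderiv (\<Sum>i\<in>A. f i) = (\<Sum>i\<in>A. pderiv (f i))"
  by (induction A rule: infinite_finite_induct) (auto simp: pderiv_add)

section \<open>Translation to univariate polynomials and the Gamma operator\<close>

locale one_variable =
  fixes k0 :: "'n::finite"
  assumes UNIV_eq: "(UNIV :: 'n set) = {k0}"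
begin

definition to_poly :: "'n mpoly \<Rightarrow> real poly" where
  "to_poly p = (\<Sum>\<alpha>\<in>Poly_Mapping.keys p. monom (Poly_Mapping.lookup p \<alpha>) (Poly_Mapping.lookup \<alpha> k0))"

lemma index_eq_iff: "\<alpha> = \<beta> \<longleftrightarrow> Poly_Mapping.lookup \<alpha> k0 = Poly_Mapping.lookup \<beta> k0"
  for \<alpha> \<beta> :: "'n \<Rightarrow>\<^sub>0 nat"
proof
  assume eq: "Poly_Mapping.lookup \<alpha> k0 = Poly_Mapping.lookup \<beta> k0"
  show "\<alpha> = \<beta>"
  proof (rule poly_mapping_eqI)
    fix k
    have "k = k0" using UNIV_eq by blast
    then show "Poly_Mapping.lookup \<alpha> k = Poly_Mapping.lookup \<beta> k" using eq by simp
  qed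
qed simp

lemma meval_to_poly: "meval p x = poly (to_poly p) (x k0)"
  by (simp add: meval_def to_poly_def poly_sum poly_monom UNIV_eq)

lemma poly_to_poly: "poly (to_poly p) x = meval p (\<lambda>_. x)"
  by (simp add: meval_to_poly)

text \<open>Real polynomials are determined by their values, which reduces the translation of sums,
  products and substitutions to the rules for \<open>meval\<close>.\<close>

lemma to_poly_eqI: "(\<And>x. meval p (\<lambda>_. x) = poly q x) \<Longrightarrow> to_poly p = q"
  unfolding poly_eq_poly_eq_iff[symmetric] by (simp add: fun_eq_iff poly_to_poly)

lemma to_poly_add: "to_poly (p + q) = to_poly p + to_poly q"
  by (rule to_poly_eqI) (simp add: meval_add poly_to_poly)

lemma to_poly_mult: "to_poly (p * q) = to_poly p * to_poly q"
  by (rule to_poly_eqI) (simp add: meval_mult poly_to_poly)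

lemma to_poly_mconst: "to_poly (mconst c) = [:c:]"
  by (rule to_poly_eqI) simp

lemma to_poly_0 [simp]: "to_poly 0 = 0"
  by (simp add: to_poly_def)

lemma to_poly_msubst: "to_poly (msubst p q) = pcompose p (to_poly q)"
  by (rule to_poly_eqI) (simp add: meval_msubst poly_to_poly poly_pcompose)

lemma to_poly_mhermite: "to_poly (mhermite \<alpha>) = hermite (Poly_Mapping.lookup \<alpha> k0)"
  by (rule to_poly_eqI) (simp add: meval_mhermite UNIV_eq)

lemma to_poly_mpderiv: "to_poly (mpderiv k0 p) = pderiv (to_poly p)"
proof (rule to_poly_eqI)
  fix x
  have "pderiv (to_poly p) = (\<Sum>\<alpha>\<in>Poly_Mapping.keys p. monom (real (Poly_Mapping.lookup \<alpha> k0) * Poly_Mapping.lookup p \<alpha>)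
      (Poly_Mapping.lookup \<alpha> k0 - 1))"
    by (simp add: to_poly_def pderiv_sum pderiv_monom)
  then show "meval (mpderiv k0 p) (\<lambda>_. x) = poly (pderiv (to_poly p)) x"
    by (simp add: mpderiv_def meval_sum meval_single mono_eval_def UNIV_eq poly_sum poly_monom lookup_minus)
qed

lemma coeff_to_poly: "coeff (to_poly p) (Poly_Mapping.lookup \<alpha> k0) = Poly_Mapping.lookup p \<alpha>"
proof -
  have "coeff (to_poly p) (Poly_Mapping.lookup \<alpha> k0) = (\<Sum>\<beta>\<in>Poly_Mapping.keys p. if \<beta> = \<alpha> then Poly_Mapping.lookup p \<beta> else 0)"
    unfolding to_poly_def coeff_sum by (intro sum.cong) (auto simp: index_eq_iff)
  then show ?thesis by (simp add: in_keys_iff)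
qed

lemma to_poly_inject: "to_poly p = to_poly q \<longleftrightarrow> p = q"
proof
  assume "to_poly p = to_poly q"
  then have "Poly_Mapping.lookup p \<alpha> = Poly_Mapping.lookup q \<alpha>" for \<alpha>
    using coeff_to_poly[of p \<alpha>] coeff_to_poly[of q \<alpha>] by simp
  then show "p = q" by (rule poly_mapping_eqI)
qed simp

text \<open>For a Hermite polynomial of degree \<open>Suc m\<close> the defining recursion already
  has this form, with \<open>c = 0\<close> and \<open>u = hermite m\<close>, and the Gamma operator
  multiplies this \<open>u\<close> by h'. The property passes to linear combinations, and
  surjectivity of \<open>HT\<close> makes these all polynomials.\<close>

lemma to_poly_gamma_op:
  "\<exists>c u. to_poly p = [:c:] + [:0, 1:] * u - pderiv u \<and> to_poly (gamma_op h p) = pderiv (to_poly h) * u"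
proof -
  define P where "P p \<longleftrightarrow> (\<exists>c u. to_poly p = [:c:] + [:0, 1:] * u - pderiv u \<and>
      to_poly (gamma_op h p) = pderiv (to_poly h) * u)" for p
  have G: "is_gamma_op h (gamma_op h)" by (rule is_gamma_op_gamma_op)
  then have lin: "mlinear (gamma_op h)" by (simp add: is_gamma_op_def)
  have G_add: "gamma_op h (p + q) = gamma_op h p + gamma_op h q" for p q
    using lin by (simp add: mlinear_def)
  have G_scale: "gamma_op h (mconst c * p) = mconst c * gamma_op h p" for c p
    using lin by (simp add: mlinear_def)
  have P_add: "P (p + q)" if "P p" "P q" for p q
  proof -
    obtain c u d v where cu: "to_poly p = [:c:] + [:0, 1:] * u - pderiv u"
        "to_poly (gamma_op h p) = pderiv (to_poly h) * u"
      and dv: "to_poly q = [:d:] + [:0, 1:] * v - pderiv v" "to_poly (gamma_op h q) = pderiv (to_poly h) * v"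
      using \<open>P p\<close> \<open>P q\<close> unfolding P_def by blast
    have "[:c:] + X * u - pderiv u + ([:d:] + X * v - pderiv v)
        = [:c + d:] + X * (u + v) - pderiv (u + v)" for X :: "real poly"
      by (simp add: pderiv_add distrib_left)
    then have "to_poly (p + q) = [:c + d:] + [:0, 1:] * (u + v) - pderiv (u + v)"
      by (simp only: to_poly_add cu dv)
    moreover have "to_poly (gamma_op h (p + q)) = pderiv (to_poly h) * (u + v)"
      by (simp only: to_poly_add G_add cu dv distrib_left)
    ultimately show ?thesis unfolding P_def by blast
  qed
  have P_scale: "P (mconst a * p)" if "P p" for a p
  proof -
    obtain c u where "to_poly p = [:c:] + [:0, 1:] * u - pderiv u" "to_poly (gamma_op h p) = pderiv (to_poly h) * u"
      using \<open>P p\<close> unfolding P_def by blast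
    then show ?thesis unfolding P_def
      by (intro exI[of _ "a * c"] exI[of _ "smult a u"])
        (simp add: to_poly_mult to_poly_mconst G_scale pderiv_smult smult_add_right smult_diff_right)
  qed
  have P_0: "P 0" unfolding P_def using mlinear_0[OF lin] by (intro exI[of _ 0]) simp
  have P_hermite: "P (mhermite \<alpha>)" for \<alpha>
  proof (cases "Poly_Mapping.lookup \<alpha> k0")
    case 0
    then have "\<alpha> = 0" by (simp add: index_eq_iff)
    then show ?thesis unfolding P_def
      using G by (intro exI[of _ 1] exI[of _ 0]) (simp add: is_gamma_op_def mhermite_0 to_poly_mhermite
        flip: to_poly_mconst mconst_1)
  next
    case (Suc m)
    then have "mdeg \<alpha> = Suc m" by (simp add: mdeg_def UNIV_eq)
    then have "gamma_op h (mhermite \<alpha>) = mconst 1 * mhermite (\<alpha> - Poly_Mapping.single k0 1) * mpderiv k0 h"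
      using G Suc by (simp add: is_gamma_op_def UNIV_eq)
    then have "to_poly (gamma_op h (mhermite \<alpha>)) = hermite m * pderiv (to_poly h)"
      by (simp add: to_poly_mult to_poly_mhermite to_poly_mpderiv lookup_minus Suc)
    moreover have "to_poly (mhermite \<alpha>) = [:0:] + [:0, 1:] * hermite m - pderiv (hermite m)"
      by (simp add: to_poly_mhermite Suc)
    ultimately show ?thesis unfolding P_def
      by (intro exI[of _ 0] exI[of _ "hermite m"]) (simp only: mult.commute)
  qed
  obtain p' where "p = HT p'" using bij_is_surj[OF bij_HT] by (rule surjE)
  moreover have "P (\<Sum>\<alpha>\<in>A. mconst (f \<alpha>) * mhermite \<alpha>)" for A f
    by (induction A rule: infinite_finite_induct) (auto intro: P_0 P_add P_scale P_hermite)
  ultimately have "P p" by (simp add: mext_def)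
  then show ?thesis by (simp add: P_def)
qed

end

section \<open>Derivatives of test functions within the support\<close>

lemma nderiv_on_tower:
  assumes lim: "\<And>y. y \<in> I \<Longrightarrow> y islimpt I" and D: "smooth_tower T D"
  shows "t \<le> T \<Longrightarrow> y \<in> I \<Longrightarrow> nderiv_on I t (D 0) y = D t y"
proof (induction t arbitrary: y)
  case (Suc t)
  have "(D t has_vector_derivative D (Suc t) y) (at y within I)"
    using D Suc.prems
    by (auto simp: smooth_tower_def has_real_derivative_iff_has_vector_derivative
        intro: has_vector_derivative_at_within)
  then have "(nderiv_on I t (D 0) has_vector_derivative D (Suc t) y) (at y within I)"
    by (rule has_vector_derivative_transform[OF Suc.prems(2), rotated]) (use Suc in auto)
  \<comment> \<open>At a limit point of \<open>I\<close> the derivative within \<open>I\<close> is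
    unique, so \<open>vector_derivative\<close> must return the derivative on the whole
    line.\<close>
  moreover have "at y within I \<noteq> bot"
    using lim[OF Suc.prems(2)] by (simp add: trivial_limit_within)
  ultimately show ?case by (simp add: vector_derivative_within)
qed simp

lemma C_on_tower:
  assumes lim: "\<And>y. y \<in> I \<Longrightarrow> y islimpt I" and D: "smooth_tower T D"
  shows "D 0 \<in> C_on T I"
proof -
  have eq: "nderiv_on I t (D 0) y = D t y" if "t \<le> T" "y \<in> I" for t y
    using nderiv_on_tower[of I T D t y] lim D that by blast
  have "nderiv_on I t (D 0) differentiable_on I" if "t < T" for t
    unfolding differentiable_on_def
  proof
    fix y assume y: "y \<in> I"
    have "(D t has_vector_derivative D (Suc t) y) (at y within I)"
      using D that
      by (auto simp: smooth_tower_def has_real_derivative_iff_has_vector_derivative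
          intro: has_vector_derivative_at_within)
    then have "(nderiv_on I t (D 0) has_vector_derivative D (Suc t) y) (at y within I)"
      by (rule has_vector_derivative_transform[OF y, rotated]) (use that in \<open>auto simp: eq\<close>)
    then show "nderiv_on I t (D 0) differentiable at y within I" by (rule differentiableI_vector)
  qed
  moreover have "continuous_on I (nderiv_on I t (D 0))" if "t \<le> T" for t
  proof -
    have "continuous_on I (D t)"
      using D that by (auto simp: smooth_tower_def intro: continuous_on_subset)
    moreover have "continuous_on I (nderiv_on I t (D 0)) \<longleftrightarrow> continuous_on I (D t)"
      by (rule continuous_on_cong) (simp_all add: eq that)
    ultimately show ?thesis by simp
  qed
  ultimately show ?thesis by (simp add: C_on_def)
qed

lemma borel_measurable_indicator_poly:
  fixes p :: "real poly"
  assumes [measurable]: "S \<in> sets borel"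
  shows "(\<lambda>x. indicator S (poly p x) :: real) \<in> borel_measurable borel"
  by measurable

section \<open>Transfer to the Gaussian variable and to \<open>Y\<close>\<close>

locale gaussian_polynomial = one_variable k0 + prob_space M
  for k0 :: "'n::finite" and M :: "'w measure" +
  fixes X :: "'n \<Rightarrow> 'w \<Rightarrow> real" and h :: "'n mpoly"
  assumes gaussian: "distributed M lborel (X k0) std_normal_density"
    and nonconstant: "\<And>c. h \<noteq> mconst c"
begin

abbreviation Z :: "'w \<Rightarrow> real" where "Z \<equiv> X k0"
abbreviation hp :: "real poly" where "hp \<equiv> to_poly h"
abbreviation Y :: "'w \<Rightarrow> real" where "Y \<equiv> rv X h"

lemma Z_measurable [measurable]: "Z \<in> borel_measurable M"
  using distributed_measurable[OF gaussian] by simp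

lemma rv_to_poly: "rv X p \<omega> = poly (to_poly p) (Z \<omega>)"
  by (simp add: rv_def meval_to_poly)

lemma integral_Z: "F \<in> borel_measurable borel \<Longrightarrow> (LINT \<omega>|M. F (Z \<omega>)) = gauss F"
  using distributed_integral[OF gaussian, of F] by simp

lemma integrable_Z:
  "F \<in> borel_measurable borel \<Longrightarrow>
    integrable M (\<lambda>\<omega>. F (Z \<omega>)) \<longleftrightarrow> integrable lborel (\<lambda>x. std_normal_density x * F x)"
  using distributed_integrable[OF gaussian, of F] by simp

lemma degree_hp: "degree hp > 0"
proof (rule ccontr)
  assume "\<not> degree hp > 0"
  then obtain c where "hp = [:c:]" by (auto elim: degree_eq_zeroE)
  then have "to_poly h = to_poly (mconst c)" by (simp add: to_poly_mconst)
  then show False using nonconstant by (simp add: to_poly_inject)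
qed

lemma measure_ball: "measure (distr M borel Y) (ball y e) = gauss (\<lambda>x. indicator (ball y e) (poly hp x))"
proof -
  have [measurable]: "Y \<in> borel_measurable M" by (simp add: rv_to_poly[abs_def])
  have "measure (distr M borel Y) (ball y e) = measure M (Y -` ball y e \<inter> space M)"
    by (intro measure_distr) auto
  also have "\<dots> = (LINT \<omega>|M. indicator (Y -` ball y e \<inter> space M) \<omega>)"
    by simp
  also have "\<dots> = (LINT \<omega>|M. indicator (ball y e) (poly hp (Z \<omega>)))"
    by (rule Bochner_Integration.integral_cong[OF refl]) (simp add: indicator_def rv_to_poly)
  also have "\<dots> = gauss (\<lambda>x. indicator (ball y e) (poly hp x))"
    by (rule integral_Z, rule borel_measurable_indicator_poly) simp
  finally show ?thesis .
qed

text \<open>By continuity \<open>hp\<close> maps a small interval at \<open>x\<close> into the ball,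
  and an interval of positive length has positive Gaussian mass.\<close>

lemma hp_in_support: "poly hp x \<in> rv_support M Y"
proof -
  have "gauss (\<lambda>z. indicator (ball (poly hp x) e) (poly hp z)) > 0" if "e > 0" for e
  proof -
    have "isCont (poly hp) x" by (rule poly_isCont)
    then obtain d where d: "d > 0" "\<And>z. dist z x < d \<Longrightarrow> dist (poly hp z) (poly hp x) < e"
      using \<open>e > 0\<close> unfolding continuous_at_eps_delta by blast
    obtain Q where Q: "\<And>z. (Q has_real_derivative std_normal_density z * poly 1 z) (at z)"
      using std_normal_antiderivative[of 1] by blast
    have "0 < Q (x + d / 2) - Q x"
    proof -
      have "Q x < Q (x + d / 2)"
        by (rule DERIV_pos_imp_increasing) (use Q d(1) normal_density_pos in \<open>force+\<close>)
      then show ?thesis by simp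
    qed
    also have "\<dots> = gauss (\<lambda>z. poly 1 z * indicator {x..x + d / 2} z)"
      using d(1) by (intro gauss_indicator_Icc[OF Q, symmetric]) simp
    also have "\<dots> \<le> gauss (\<lambda>z. indicator (ball (poly hp x) e) (poly hp z))"
    proof (rule integral_mono)
      show "integrable lborel (\<lambda>z. std_normal_density z * (poly 1 z * indicator {x..x + d / 2} z))"
        by (rule integrable_std_normal_indicator) auto
      have "integrable lborel (\<lambda>z. std_normal_density z * (poly 1 z * indicator (ball (poly hp x) e) (poly hp z)))"
        by (rule integrable_std_normal_indicator) auto
      then show "integrable lborel (\<lambda>z. std_normal_density z * indicator (ball (poly hp x) e) (poly hp z))"
        by simp
      fix z
      have "dist (poly hp x) (poly hp z) < e" if "x \<le> z" "z \<le> x + d / 2"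
        using d(2)[of z] d(1) that by (simp add: dist_real_def abs_minus_commute)
      then show "std_normal_density z * (poly 1 z * indicator {x..x + d / 2} z)
          \<le> std_normal_density z * indicator (ball (poly hp x) e) (poly hp z)"
        by (auto simp: indicator_def)
    qed
    finally show ?thesis .
  qed
  then show ?thesis by (simp add: rv_support_def measure_ball)
qed

text \<open>Otherwise the event that \<open>Y\<close> is close to \<open>y\<close> would force Z to
  be one of the finitely many roots of \<open>hp - [:y:]\<close>, a null event, against the positive
  mass near a support point.\<close>

lemma support_islimpt:
  assumes y: "y \<in> rv_support M Y"
  shows "y islimpt rv_support M Y"
  unfolding islimpt_approachable
proof (intro allI impI)
  fix e :: real assume "e > 0"
  show "\<exists>x'\<in>rv_support M Y. x' \<noteq> y \<and> dist x' y < e"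
  proof (rule ccontr)
    assume no: "\<not> ?thesis"
    have "hp - [:y:] \<noteq> 0" using degree_hp by (metis degree_pCons_0 eq_iff_diff_eq_0 less_numeral_extra(3))
    then have "finite {x. poly (hp - [:y:]) x = 0}" by (rule poly_roots_finite)
    moreover have "{x. dist y (poly hp x) < e} \<subseteq> {x. poly (hp - [:y:]) x = 0}"
      using no hp_in_support by (auto simp: dist_commute)
    ultimately have "finite {x. dist y (poly hp x) < e}" by (rule finite_subset[rotated])
    then have "AE x in lborel. x \<notin> {x. dist y (poly hp x) < e}"
      by (intro AE_not_in finite_imp_null_set_lborel)
    then have "gauss (\<lambda>x. indicator (ball y e) (poly hp x)) = 0"
      by (intro integral_eq_zero_AE) (auto elim!: eventually_mono simp: indicator_def)
    moreover have "gauss (\<lambda>x. indicator (ball y e) (poly hp x)) > 0"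
      using y \<open>e > 0\<close> by (simp add: rv_support_def measure_ball)
    ultimately show False by linarith
  qed
qed

text \<open>\<open>q\<^sub>t = g\<^sub>t + p\<^sub>t(h)\<close>, as a univariate polynomial.\<close>

definition chain_sum :: "real poly list \<Rightarrow> nat \<Rightarrow> real poly" where
  "chain_sum ps t = to_poly (chain_poly h ps t) + pcompose (ps ! t) hp"

lemma rv_chain_sum: "rv X (chain_poly h ps t) \<omega> + poly (ps ! t) (Y \<omega>) = poly (chain_sum ps t) (Z \<omega>)"
  by (simp add: chain_sum_def rv_to_poly poly_pcompose)

lemma chain_sum_0: "chain_sum ps 0 = pcompose (ps ! 0) hp"
  by (simp add: chain_sum_def)

lemma chain_sum_step:
  "\<exists>c u. \<forall>t. chain_sum ps t = [:c t:] + [:0, 1:] * u t - pderiv (u t) \<and>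
     chain_sum ps (Suc t) = pderiv hp * u t + pcompose (ps ! Suc t) hp"
proof -
  have "chain_sum ps t = to_poly (chain_poly h ps t + msubst (ps ! t) h)" for t
    by (simp add: chain_sum_def to_poly_add to_poly_msubst)
  then have "\<exists>c u. chain_sum ps t = [:c:] + [:0, 1:] * u - pderiv u \<and>
      to_poly (chain_poly h ps (Suc t)) = pderiv hp * u" for t
    using to_poly_gamma_op[of "chain_poly h ps t + msubst (ps ! t) h" h] by simp
  then obtain c u where cu: "\<And>t. chain_sum ps t = [:c t:] + [:0, 1:] * u t - pderiv (u t)"
      "\<And>t. to_poly (chain_poly h ps (Suc t)) = pderiv hp * u t"
    by metis
  have "chain_sum ps (Suc t) = pderiv hp * u t + pcompose (ps ! Suc t) hp" for t
    by (simp only: chain_sum_def[of ps "Suc t"] cu(2))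
  with cu(1) show ?thesis by blast
qed

lemma integral_chain_sum:
  "(LINT \<omega>|M. rv X (chain_poly h ps t) \<omega>) = - (LINT \<omega>|M. poly (ps ! t) (Y \<omega>))
    \<longleftrightarrow> gauss (poly (chain_sum ps t)) = 0"
proof -
  have int: "integrable M (\<lambda>\<omega>. poly p (Z \<omega>))" for p
    by (subst integrable_Z) (auto intro: integrable_std_normal_poly)
  have "gauss (poly (chain_sum ps t)) = (LINT \<omega>|M. poly (chain_sum ps t) (Z \<omega>))"
    by (rule integral_Z[symmetric]) simp
  also have "\<dots> = (LINT \<omega>|M. poly (to_poly (chain_poly h ps t)) (Z \<omega>) + poly (pcompose (ps ! t) hp) (Z \<omega>))"
    by (simp add: chain_sum_def)
  also have "\<dots> = (LINT \<omega>|M. rv X (chain_poly h ps t) \<omega>) + (LINT \<omega>|M. poly (ps ! t) (Y \<omega>))"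
    by (simp add: Bochner_Integration.integral_add[OF int int] rv_to_poly[abs_def] flip: poly_pcompose)
  finally show ?thesis by linarith
qed

lemma chain_sum_eq_0:
  assumes "\<And>a b. a \<le> b \<Longrightarrow> gauss (\<lambda>x. poly (chain_sum ps T) x * indicator {a..b} (poly hp x)) = 0"
  shows "chain_sum ps T = 0"
proof -
  obtain c u where "\<And>t. chain_sum ps t = [:c t:] + [:0, 1:] * u t - pderiv (u t)"
    and "\<And>t. chain_sum ps (Suc t) = pderiv hp * u t + pcompose (ps ! Suc t) hp"
    using chain_sum_step[of ps] by blast
  then show ?thesis
    using stein_chain_terminal_eq_0[where q = "chain_sum ps" and p = "\<lambda>t. ps ! t", OF degree_hp chain_sum_0 _ _ assms]
    by blast
qed

text \<open>Indicators of level intervals of \<open>Y\<close> belong to \<open>H_space\<close>, so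
  orthogonality yields the vanishing integrals that \<open>chain_sum_eq_0\<close> requires.\<close>

lemma SC_chain_sum_eq_0:
  assumes "ps \<in> SC K M X h T"
  shows "chain_sum ps T = 0"
proof (rule chain_sum_eq_0)
  fix a b :: real
  have "(\<lambda>\<omega>. indicator {a..b} (Y \<omega>) :: real) \<in> H_space M Y"
    unfolding H_space_def
  proof (intro CollectI conjI)
    have "Y \<in> measurable (vimage_algebra (space M) Y borel) borel"
      by (rule measurable_vimage_algebra1) simp
    then show "(\<lambda>\<omega>. indicator {a..b} (Y \<omega>) :: real) \<in> borel_measurable (vimage_algebra (space M) Y borel)"
      by measurable
    have [measurable]: "Y \<in> borel_measurable M" by (simp add: rv_to_poly[abs_def])
    show "integrable M (\<lambda>\<omega>. (indicator {a..b} (Y \<omega>) :: real)\<^sup>2)"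
      by (rule integrable_const_bound[of _ 1]) (auto simp: indicator_def)
  qed
  then have "(LINT \<omega>|M. poly (chain_sum ps T) (Z \<omega>) * indicator {a..b} (Y \<omega>)) = 0"
    using assms by (simp add: SC_def H_perp_def rv_chain_sum)
  then show "gauss (\<lambda>x. poly (chain_sum ps T) x * indicator {a..b} (poly hp x)) = 0"
    using integral_Z[of "\<lambda>x. poly (chain_sum ps T) x * indicator {a..b} (poly hp x)"]
    by (simp add: rv_to_poly)
qed

lemma ASC_I:
  assumes "ps \<in> poly_seqs K T" and "chain_sum ps T = 0"
    and "\<And>t. t \<le> T \<Longrightarrow> gauss (poly (chain_sum ps t)) = 0"
  shows "ps \<in> ASC K M X h T"
  using assms by (simp add: ASC_def SC_def rv_chain_sum integral_chain_sum H_perp_def L2_rv_def)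

text \<open>Polynomial growth makes \<open>D 0\<close> an admissible test function, and on the range
  of \<open>Y\<close>, which lies in the support, its derivatives are those of the tower.\<close>

lemma PSO_stein_identity:
  assumes ps: "ps \<in> PSO K M X h" and len: "length ps = Suc T" and D: "smooth_tower T D"
  shows "gauss (\<lambda>x. \<Sum>t\<le>T. poly (ps ! t) (poly hp x) * D t (poly hp x)) = 0"
proof -
  define I where "I = rv_support M Y"
  have nd: "nderiv_on I t (D 0) (poly hp (Z \<omega>)) = D t (poly hp (Z \<omega>))" if "t \<le> T" for t \<omega>
    using nderiv_on_tower[OF _ D that, of I "poly hp (Z \<omega>)"] support_islimpt hp_in_support
    by (simp add: I_def)
  have "D 0 \<in> test_functions M Y ps"
  proof -
    have "integrable M (\<lambda>\<omega>. Y \<omega> ^ j * nderiv_on I t (D 0) (Y \<omega>))" if "t \<le> T" for t j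
    proof -
      have [measurable]: "D t \<in> borel_measurable borel" using D that by (rule smooth_tower_measurable)
      have "integrable M (\<lambda>\<omega>. poly (hp ^ j) (Z \<omega>) * D t (poly hp (Z \<omega>)))"
        using integrable_std_normal_tower[OF D that, of "hp ^ j" hp] by (subst integrable_Z) auto
      then show ?thesis by (simp add: nd[OF that] rv_to_poly)
    qed
    then show ?thesis
      using C_on_tower[of I T D] support_islimpt D by (simp add: test_functions_def len I_def Let_def)
  qed
  then have "(LINT \<omega>|M. stein_apply ps I (D 0) (Y \<omega>)) = 0"
    using ps by (auto simp: PSO_def I_def)
  moreover have "stein_apply ps I (D 0) (Y \<omega>) = (\<Sum>t\<le>T. poly (ps ! t) (poly hp (Z \<omega>)) * D t (poly hp (Z \<omega>)))" for \<omega>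
    unfolding stein_apply_def len lessThan_Suc_atMost by (intro sum.cong) (auto simp: nd rv_to_poly)
  moreover have "(\<lambda>x. \<Sum>t\<le>T. poly (ps ! t) (poly hp x) * D t (poly hp x)) \<in> borel_measurable borel"
    using smooth_tower_measurable[OF D] by (intro borel_measurable_sum borel_measurable_times) auto
  ultimately show ?thesis
    using integral_Z[of "\<lambda>x. \<Sum>t\<le>T. poly (ps ! t) (poly hp x) * D t (poly hp x)"] by simp
qed

text \<open>The monomial tests give the mean conditions of a chain, and the ramp tests give
  vanishing integrals over level intervals, hence a zero terminal polynomial.\<close>

lemma PSO_imp_ASC:
  assumes ps: "ps \<in> PSO K M X h"
  shows "ps \<in> ASC K M X h (length ps - 1)"
proof -
  obtain T where T: "ps \<in> poly_seqs K T" using ps by (auto simp: PSO_def)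
  then have len: "length ps = Suc T" by (simp add: poly_seqs_def)
  obtain c u where "\<And>t. chain_sum ps t = [:c t:] + [:0, 1:] * u t - pderiv (u t)"
    and "\<And>t. chain_sum ps (Suc t) = pderiv hp * u t + pcompose (ps ! Suc t) hp"
    using chain_sum_step[of ps] by blast
  note tests = gauss_stein_chain_tests[where q = "chain_sum ps" and p = "\<lambda>t. ps ! t",
      OF chain_sum_0 this PSO_stein_identity[OF ps len]]
  have "chain_sum ps T = 0"
    by (rule chain_sum_eq_0, rule gauss_indicator_eq_0) (rule tests(2))
  then show ?thesis
    using T tests(1) by (simp add: len ASC_I)
qed

lemma ASC_eq_SC: "ASC K M X h T = SC K M X h T"
proof
  show "SC K M X h T \<subseteq> ASC K M X h T"
    using SC_chain_sum_eq_0 by (auto simp: ASC_def rv_chain_sum)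
qed (auto simp: ASC_def)

end

theorem proposition3p2:
  fixes K :: "real set"
    and M :: "'w measure"
    and X :: "'n::finite \<Rightarrow> 'w \<Rightarrow> real"
    and h :: "'n mpoly"
  assumes K: "K \<in> {\<int>, \<rat>, \<real>}"
    and M: "prob_space M"
    and X_indep: "prob_space.indep_vars M (\<lambda>_. borel) X UNIV"
    and X_gauss: "\<And>k. distributed M lborel (X k) std_normal_density"
    and h_coeffs: "\<And>\<alpha>. Poly_Mapping.lookup h \<alpha> \<in> K"
    and h_nonconst: "\<And>c. h \<noteq> mconst c"
    and h_mean: "(LINT \<omega>|M. rv X h \<omega>) = 0"
  shows "APSO K M X h \<subseteq> PSO K M X h \<and>
    (CARD('n) = 1 \<longrightarrow>
       APSO K M X h = PSO K M X h \<and> (\<forall>T\<ge>1. ASC K M X h T = SC K M X h T))"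
proof (intro conjI impI)
  show sub: "APSO K M X h \<subseteq> PSO K M X h" by (auto simp: APSO_def)
  assume "CARD('n) = 1"
  then obtain k0 :: 'n where k0: "UNIV = {k0}" by (auto simp: card_1_singleton_iff)
  interpret prob_space M by (rule M)
  interpret gaussian_polynomial k0 M X h
    by unfold_locales (fact k0, fact X_gauss, fact h_nonconst)
  show "APSO K M X h = PSO K M X h" using PSO_imp_ASC by (auto simp: APSO_def)
  show "\<forall>T\<ge>1. ASC K M X h T = SC K M X h T" by (simp add: ASC_eq_SC)
qed

end
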